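(* Let $k$ be a positive integer and $\mu$ a partition with $\mu_1\le n$. Then $$\mathbf I_k(n)\cdot v_{\widetilde\mu}=h^*_k(\widetilde\mu)\,v_{\widetilde\mu},\qquad h^*_k(\widetilde\mu)\in\mathbb N,$$ with $$h^*_k(\widetilde\mu)=\sum vstrip_\mu(k)!,$$ where the sum is extended over all vertical strips of length $k$ in the Ferrers diagram of $\mu$, and $vstrip_\mu(k)!$ denotes the product of the factorials of the cardinalities of the vertical components of the vertical strip.
   Context: Strips (in generalized sense): a vertical strip of length $k$ in a Ferrers diagram is a subset of $k$ cells such that no two cells of the subset lie in the same row; its vertical components are the sets of all its cells lying in the same column. Virtual symbols. Let $\mathcal L=\{1,\dots,n\}$, and let $\mathcal A_0$, $\mathcal A_1$ be finite sets of auxiliary (virtual) symbols, sufficiently large. Put $|a|=0\in\mathbb Z_2$ for $a\in\mathcal A_0$ and $|a|=1\in\mathbb Z_2$ for $a\in\mathcal A_1\cup\mathcal L$. Let $gl(m_0|m_1+n)$ ($m_0=|\mathcal A_0|$, $m_1=|\mathcal A_1|$) be the complex Lie superalgebra with basis $e_{a,b}$, $a,b\in\mathcal A_0\cup\mathcal A_1\cup\mathcal L$, $|e_{a,b}|=|a|+|b|$, and superbracket $[e_{a,b},e_{c,d}]=\delta_{bc}e_{a,d}-(-1)^{(|a|+|b|)(|c|+|d|)}\delta_{ad}e_{c,b}$. Its enveloping superalgebra $\mathbf U(gl(m_0|m_1+n))$ contains $\mathbf U(gl(n))$ as the subalgebra generated by $e_{i,j}$, $i,j\in\mathcal L$. Devirtualization.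 A product $e_{a_m,b_m}\cdots e_{a_1,b_1}$ is irregular if there are $i\le m$ and a virtual symbol $\gamma\in\mathcal A_0\cup\mathcal A_1$ with $\#\{j\le i: b_j=\gamma\}>\#\{j<i: a_j=\gamma\}$. Let $\mathbf{Irr}$ be the left ideal of $\mathbf U(gl(m_0|m_1+n))$ generated by the irregular products. The sum $Virt=\mathbf U(gl(n))+\mathbf{Irr}$ is direct and is a subalgebra, in which $\mathbf{Irr}$ is a two-sided ideal; $\mathfrak p:Virt\to\mathbf U(gl(n))$ denotes the projection with kernel $\mathbf{Irr}$ (an algebra epimorphism). Nazarov elements. For any $\beta\in\mathcal A_1$ and $k\in\mathbb Z^+$, $\mathbf I_k(n)=\sum_{h_1+\cdots+h_n=k}\frac1{h_1!\cdots h_n!}\,\mathfrak p\big(e_{n,\beta}^{h_n}\cdots e_{2,\beta}^{h_2}e_{1,\beta}^{h_1}\,e_{\beta,1}^{h_1}e_{\beta,2}^{h_2}\cdots e_{\beta,n}^{h_n}\big)\in\mathbf U(gl(n))$, the sum over all $n$-tuples of nonnegative integers with sum $k$. It is a central element. Schur modules. Let $\mathbb C[M_{n,d}]$ be the polynomial algebra in commuting variables $(i|j)$, $1\le i\le n$, $1\le j\le d$, with $gl(n)$ acting by derivations, $e_{i,j}\cdot(k|t)=\delta_{jk}(i|t)$, and $d$ sufficiently large. For a partition $\mu$ with $\mu_1\le n$, $Schur_\mu(n)\subset\mathbb C[M_{n,d}]$ is the span of all products $\prod_r\det[(X_{r,s}|t)]_{s,t=1,\dots,\mu_r}$, $X=(X_{r,s})$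 any filling of the Ferrers diagram of $\mu$ with elements of $\mathcal L$; it is an irreducible $gl(n)$-module with highest weight the conjugate partition $\widetilde\mu$. Its canonical highest weight vector $v_{\widetilde\mu}$ is, up to a fixed sign, $\prod_r\det[(s|t)]_{s,t=1,\dots,\mu_r}$. *)

theory Defs
  imports
    "HOL-Library.Poly_Mapping"
    "HOL-Library.FuncSet"
    "HOL-Algebra.QuotRing"
    "HOL-Algebra.Generated_Rings"
    "Jordan_Normal_Form.Determinant"
begin

section \<open>Scalars in monoid algebras over the complex numbers\<close>

text \<open>Both the polynomial algebra and the free associative algebra are finitely supported
  functions on a monoid; \<open>scal c * p\<close> is the scalar multiple \<open>c p\<close>.\<close>

definition scal :: "complex \<Rightarrow> ('k::zero \<Rightarrow>\<^sub>0 complex)" where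
  "scal c = Poly_Mapping.single 0 c"


section \<open>The free associative algebra\<close>

text \<open>Words are wrapped lists, so that concatenation can be the additively written monoid
  structure which the convolution product of \<^theory>\<open>HOL-Library.Poly_Mapping\<close> expects.\<close>

datatype 'x mword = MWord (mletters: "'x list")

instantiation mword :: (type) monoid_add
begin
definition "0 = MWord []"
definition "u + v = MWord (mletters u @ mletters v)"
instance
  by standard (simp_all add: zero_mword_def plus_mword_def)
end

definition fword :: "'x list \<Rightarrow> ('x mword \<Rightarrow>\<^sub>0 complex)" where
  "fword w = Poly_Mapping.single (MWord w) 1"

definition free_alg :: "'x set \<Rightarrow> ('x mword \<Rightarrow>\<^sub>0 complex) ring" where
  "free_alg X = \<lparr>carrier = {f. \<forall>w\<in>Poly_Mapping.keys f. set (mletters w) \<subseteq> X},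
     monoid.mult = (*), one = 1, ring.zero = 0, add = (+)\<rparr>"

lemma fword_Nil: "fword [] = 1"
  by (simp add: fword_def zero_mword_def[symmetric])

lemma fword_append: "fword (u @ v) = fword u * fword v"
  by (simp add: fword_def mult_single plus_mword_def)

lemma ring_free_alg: "ring (free_alg X)"
proof (rule ringI)
  show "abelian_group (free_alg X)"
  proof (rule abelian_groupI)
    fix f assume "f \<in> carrier (free_alg X)"
    then show "\<exists>g\<in>carrier (free_alg X). g \<oplus>\<^bsub>free_alg X\<^esub> f = \<zero>\<^bsub>free_alg X\<^esub>"
      by (intro bexI[of _ "- f"]) (auto simp: free_alg_def)
  next
    fix f g assume "f \<in> carrier (free_alg X)" "g \<in> carrier (free_alg X)"
    then show "f \<oplus>\<^bsub>free_alg X\<^esub> g \<in> carrier (free_alg X)"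
      using Poly_Mapping.keys_add[of f g] by (fastforce simp: free_alg_def)
  qed (auto simp: free_alg_def algebra_simps)
  show "Group.monoid (free_alg X)"
  proof
    fix f g assume fg: "f \<in> carrier (free_alg X)" "g \<in> carrier (free_alg X)"
    show "f \<otimes>\<^bsub>free_alg X\<^esub> g \<in> carrier (free_alg X)"
      using fg keys_mult[of f g] by (fastforce simp: free_alg_def plus_mword_def)
  qed (auto simp: free_alg_def algebra_simps zero_mword_def)
qed (auto simp: free_alg_def algebra_simps)


section \<open>The enveloping superalgebra\<close>

text \<open>The symbols in \<open>\<A>\<^sub>0\<close>, \<open>\<A>\<^sub>1\<close> and \<open>\<L>\<close>, tagged so that the three alphabets are disjoint.\<close>

datatype ('a, 'b) symb = Virt0 'a | Virt1 'b | Prop nat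

fun par :: "('a, 'b) symb \<Rightarrow> nat" where
  "par (Virt0 _) = 0"
| "par (Virt1 _) = 1"
| "par (Prop _) = 1"

definition propers :: "nat \<Rightarrow> ('a, 'b) symb set" where
  "propers n = Prop ` {1..n}"

definition virtuals :: "'a set \<Rightarrow> 'b set \<Rightarrow> ('a, 'b) symb set" where
  "virtuals A0 A1 = Virt0 ` A0 \<union> Virt1 ` A1"

definition symbs :: "'a set \<Rightarrow> 'b set \<Rightarrow> nat \<Rightarrow> ('a, 'b) symb set" where
  "symbs A0 A1 n = virtuals A0 A1 \<union> propers n"

text \<open>A letter \<open>(a, b)\<close> stands for the generator \<open>e\<^sub>a\<^sub>b\<close>; \<open>tens S\<close> is the tensor algebra of the general
  linear Lie superalgebra with index set \<open>S\<close>.\<close>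

type_synonym ('a, 'b) talg = "(('a, 'b) symb \<times> ('a, 'b) symb) mword \<Rightarrow>\<^sub>0 complex"

definition tens :: "('a, 'b) symb set \<Rightarrow> ('a, 'b) talg ring" where
  "tens S = free_alg (S \<times> S)"

text \<open>\<open>e\<^sub>a\<^sub>b e\<^sub>c\<^sub>d - (-1)\<^bsup>(|a|+|b|)(|c|+|d|)\<^esup> e\<^sub>c\<^sub>d e\<^sub>a\<^sub>b - [e\<^sub>a\<^sub>b, e\<^sub>c\<^sub>d]\<close>\<close>

definition super_rel ::
  "('a, 'b) symb \<Rightarrow> ('a, 'b) symb \<Rightarrow> ('a, 'b) symb \<Rightarrow> ('a, 'b) symb \<Rightarrow> ('a, 'b) talg" where
  "super_rel a b c d =
     (let s = (- 1) ^ ((par a + par b) * (par c + par d)) in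
        fword [(a, b), (c, d)] - s * fword [(c, d), (a, b)]
        - ((if b = c then fword [(a, d)] else 0) - s * (if a = d then fword [(c, b)] else 0)))"

definition env_ideal :: "('a, 'b) symb set \<Rightarrow> ('a, 'b) talg set" where
  "env_ideal S = Idl\<^bsub>tens S\<^esub> {super_rel a b c d | a b c d. a \<in> S \<and> b \<in> S \<and> c \<in> S \<and> d \<in> S}"

definition env :: "('a, 'b) symb set \<Rightarrow> ('a, 'b) talg set ring" where
  "env S = tens S Quot env_ideal S"

definition env_class :: "('a, 'b) symb set \<Rightarrow> ('a, 'b) talg \<Rightarrow> ('a, 'b) talg set" where
  "env_class S f = env_ideal S +>\<^bsub>tens S\<^esub> f"

text \<open>The subalgebra \<open>\<^bold>U(gl(n))\<close>; the generators include the scalars, since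
  \<^const>\<open>generate_ring\<close> only produces a subring.\<close>

definition env_gl :: "'a set \<Rightarrow> 'b set \<Rightarrow> nat \<Rightarrow> ('a, 'b) talg set set" where
  "env_gl A0 A1 n = (let S = symbs A0 A1 n in
     generate_ring (env S)
       (range (\<lambda>c. env_class S (scal c)) \<union>
        {env_class S (fword [(Prop i, Prop j)]) | i j. i \<in> {1..n} \<and> j \<in> {1..n}}))"


section \<open>Devirtualization\<close>

text \<open>A product \<open>e\<^bsub>a\<^sub>m b\<^sub>m\<^esub> \<dots> e\<^bsub>a\<^sub>1 b\<^sub>1\<^esub>\<close> is listed from left to right, so the
  condition is read off the reversed list; \<open>i\<close> below is one less than in the usual indexing.\<close>

definition irregular ::
  "'a set \<Rightarrow> 'b set \<Rightarrow> (('a, 'b) symb \<times> ('a, 'b) symb) list \<Rightarrow> bool" where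
  "irregular A0 A1 w \<longleftrightarrow>
     (\<exists>i < length w. \<exists>\<gamma> \<in> virtuals A0 A1.
        count_list (map snd (take (Suc i) (rev w))) \<gamma> > count_list (map fst (take i (rev w))) \<gamma>)"

definition gen_left_ideal :: "('r, 'm) ring_scheme \<Rightarrow> 'r set \<Rightarrow> 'r set" where
  "gen_left_ideal R X =
     \<Inter> {I. additive_subgroup I R \<and> (\<forall>x \<in> carrier R. \<forall>y \<in> I. x \<otimes>\<^bsub>R\<^esub> y \<in> I) \<and> X \<subseteq> I}"

definition Irr :: "'a set \<Rightarrow> 'b set \<Rightarrow> nat \<Rightarrow> ('a, 'b) talg set set" where
  "Irr A0 A1 n = (let S = symbs A0 A1 n in
     gen_left_ideal (env S)
       {env_class S (fword w) | w. set w \<subseteq> S \<times> S \<and> irregular A0 A1 w})"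

definition Virt :: "'a set \<Rightarrow> 'b set \<Rightarrow> nat \<Rightarrow> ('a, 'b) talg set set" where
  "Virt A0 A1 n = env_gl A0 A1 n <+>\<^bsub>env (symbs A0 A1 n)\<^esub> Irr A0 A1 n"

text \<open>The sum defining \<^const>\<open>Virt\<close> is direct, so the element chosen here is the unique one.\<close>

definition devirt :: "'a set \<Rightarrow> 'b set \<Rightarrow> nat \<Rightarrow> ('a, 'b) talg set \<Rightarrow> ('a, 'b) talg set" where
  "devirt A0 A1 n = (\<lambda>x \<in> Virt A0 A1 n.
     SOME u. u \<in> env_gl A0 A1 n \<and> x \<ominus>\<^bsub>env (symbs A0 A1 n)\<^esub> u \<in> Irr A0 A1 n)"


section \<open>Nazarov elements\<close>

definition nazarov_word ::
  "nat \<Rightarrow> 'b \<Rightarrow> (nat \<Rightarrow> nat) \<Rightarrow> (('a, 'b) symb \<times> ('a, 'b) symb) list" where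
  "nazarov_word n \<beta> h =
     concat (map (\<lambda>i. replicate (h i) (Prop i, Virt1 \<beta>)) (rev [1..<Suc n])) @
     concat (map (\<lambda>i. replicate (h i) (Virt1 \<beta>, Prop i)) [1..<Suc n])"

definition nazarov :: "'a set \<Rightarrow> 'b set \<Rightarrow> nat \<Rightarrow> 'b \<Rightarrow> nat \<Rightarrow> ('a, 'b) talg set" where
  "nazarov A0 A1 n \<beta> k = (let S = symbs A0 A1 n in
     \<Oplus>\<^bsub>env S\<^esub>h \<in> {h \<in> {1..n} \<rightarrow>\<^sub>E UNIV. (\<Sum>i = 1..n. h i) = k}.
       env_class S (scal (1 / (\<Prod>i = 1..n. fact (h i))))
       \<otimes>\<^bsub>env S\<^esub> devirt A0 A1 n (env_class S (fword (nazarov_word n \<beta> h))))"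


section \<open>The polynomial representation\<close>

text \<open>The variable \<open>(i|t)\<close> is indexed by the pair \<open>(i, t)\<close>.\<close>

type_synonym cpoly = "((nat \<times> nat) \<Rightarrow>\<^sub>0 nat) \<Rightarrow>\<^sub>0 complex"

definition pvar :: "nat \<Rightarrow> nat \<Rightarrow> cpoly" where
  "pvar i t = Poly_Mapping.single (Poly_Mapping.single (i, t) 1) 1"

definition poly_M :: "nat \<Rightarrow> nat \<Rightarrow> cpoly set" where
  "poly_M n d = {p. \<forall>m \<in> Poly_Mapping.keys p. Poly_Mapping.keys m \<subseteq> {1..n} \<times> {1..d}}"

text \<open>The derivation of the polynomial algebra which sends each variable \<open>x\<close> to \<open>g x\<close>.\<close>

definition derivation :: "(nat \<times> nat \<Rightarrow> cpoly) \<Rightarrow> cpoly \<Rightarrow> cpoly" where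
  "derivation g p =
     (\<Sum>m \<in> Poly_Mapping.keys p. \<Sum>x \<in> Poly_Mapping.keys m.
        Poly_Mapping.single (m - Poly_Mapping.single x 1)
          (Poly_Mapping.lookup p m * of_nat (Poly_Mapping.lookup m x)) * g x)"

lemma derivation_sum:
  assumes "finite K" "Poly_Mapping.keys p \<subseteq> K"
  shows "derivation g p = (\<Sum>m \<in> K. \<Sum>x \<in> Poly_Mapping.keys m.
           Poly_Mapping.single (m - Poly_Mapping.single x 1)
             (Poly_Mapping.lookup p m * of_nat (Poly_Mapping.lookup m x)) * g x)"
  unfolding derivation_def
  by (rule sum.mono_neutral_left) (use assms in \<open>auto simp: in_keys_iff\<close>)

lemma derivation_add: "derivation g (p + q) = derivation g p + derivation g q"
proof -
  let ?K = "Poly_Mapping.keys p \<union> Poly_Mapping.keys q"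
  have "Poly_Mapping.keys (p + q) \<subseteq> ?K" by (rule Poly_Mapping.keys_add)
  then show ?thesis
    by (simp add: derivation_sum[of ?K] lookup_add sum.distrib[symmetric] distrib_right single_add)
qed

lemma derivation_single_sum:
  assumes "finite L" "Poly_Mapping.keys m \<subseteq> L"
  shows "derivation g (Poly_Mapping.single m c) = (\<Sum>x \<in> L.
           Poly_Mapping.single (m - Poly_Mapping.single x 1) (c * of_nat (Poly_Mapping.lookup m x)) * g x)"
proof -
  have "derivation g (Poly_Mapping.single m c) = (\<Sum>x \<in> Poly_Mapping.keys m.
           Poly_Mapping.single (m - Poly_Mapping.single x 1) (c * of_nat (Poly_Mapping.lookup m x)) * g x)"
    by (subst derivation_sum[of "{m}"]) simp_all
  also have "\<dots> = (\<Sum>x \<in> L.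
           Poly_Mapping.single (m - Poly_Mapping.single x 1) (c * of_nat (Poly_Mapping.lookup m x)) * g x)"
    by (rule sum.mono_neutral_left) (use assms in \<open>auto simp: in_keys_iff\<close>)
  finally show ?thesis .
qed

lemma derivation_pvar: "derivation g (pvar i t) = g (i, t)"
  unfolding pvar_def by (subst derivation_single_sum[of "{(i, t)}"]) simp_all

lemma single_shift:
  fixes m m' :: "'x \<Rightarrow>\<^sub>0 nat"
  shows "Poly_Mapping.single (m + m' - Poly_Mapping.single x 1) (c * of_nat (Poly_Mapping.lookup m x))
   = Poly_Mapping.single (m - Poly_Mapping.single x 1) (c * of_nat (Poly_Mapping.lookup m x) :: complex)
       * Poly_Mapping.single m' 1"
proof (cases "Poly_Mapping.lookup m x = 0")
  case False
  have "m + m' - Poly_Mapping.single x 1 = (m - Poly_Mapping.single x 1) + m'"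
    using False by (intro poly_mapping_eqI) (auto simp: lookup_add lookup_minus lookup_single when_def)
  then show ?thesis by (simp add: mult_single)
qed simp

lemma derivation_mult_single:
  "derivation g (Poly_Mapping.single m a * Poly_Mapping.single m' b) =
     derivation g (Poly_Mapping.single m a) * Poly_Mapping.single m' b +
     Poly_Mapping.single m a * derivation g (Poly_Mapping.single m' b)"
proof -
  let ?L = "Poly_Mapping.keys m \<union> Poly_Mapping.keys m'"
  let ?x = "\<lambda>x. Poly_Mapping.single x (1::nat)"
  have L: "Poly_Mapping.keys (m + m') \<subseteq> ?L" by (rule Poly_Mapping.keys_add)
  have *: "Poly_Mapping.single (m + m' - ?x x)
        (a * b * of_nat (Poly_Mapping.lookup (m + m') x)) * g x
     = (Poly_Mapping.single (m - ?x x) (a * of_nat (Poly_Mapping.lookup m x)) * g x)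
         * Poly_Mapping.single m' b
      + Poly_Mapping.single m a
         * (Poly_Mapping.single (m' - ?x x) (b * of_nat (Poly_Mapping.lookup m' x)) * g x)" for x
  proof -
    have "Poly_Mapping.single (m + m' - ?x x) (a * b * of_nat (Poly_Mapping.lookup (m + m') x))
      = Poly_Mapping.single (m + m' - ?x x) (a * b * of_nat (Poly_Mapping.lookup m x))
      + Poly_Mapping.single (m' + m - ?x x) (a * b * of_nat (Poly_Mapping.lookup m' x))"
      by (simp add: lookup_add single_add[symmetric] algebra_simps)
    also have "\<dots> = Poly_Mapping.single (m - ?x x) (a * of_nat (Poly_Mapping.lookup m x)) * Poly_Mapping.single m' b
      + Poly_Mapping.single m a * Poly_Mapping.single (m' - ?x x) (b * of_nat (Poly_Mapping.lookup m' x))"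
      unfolding single_shift by (simp add: mult_single algebra_simps)
    finally show ?thesis by (simp add: algebra_simps)
  qed
  have fin: "finite ?L" by simp
  show ?thesis
    unfolding mult_single derivation_single_sum[OF fin L]
      derivation_single_sum[OF fin Un_upper1] derivation_single_sum[OF fin Un_upper2]
      * sum.distrib sum_distrib_left sum_distrib_right ..
qed

lemma cpoly_induct [case_names single add]:
  assumes "\<And>m c. P (Poly_Mapping.single m c)" "\<And>p q. P p \<Longrightarrow> P q \<Longrightarrow> P (p + q)"
  shows "P (p :: cpoly)"
proof (induction p rule: update_induct)
  case const show ?case using assms(1)[of 0 0] by (simp add: zero_poly_mapping_def[symmetric])
next
  case (update f a b)
  have "Poly_Mapping.update a b f = f + Poly_Mapping.single a b"
    using update by (intro poly_mapping_eqI) (auto simp: lookup_update lookup_add lookup_single in_keys_iff when_def)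
  then show ?case using assms update by simp
qed

lemma derivation_mult: "derivation g (p * q) = derivation g p * q + p * derivation g q"
proof (induction p rule: cpoly_induct)
  case (single m c)
  show ?case
    by (induction q rule: cpoly_induct)
       (simp_all add: derivation_mult_single derivation_add algebra_simps)
qed (simp add: derivation_add algebra_simps)

definition polar :: "nat \<Rightarrow> nat \<Rightarrow> cpoly \<Rightarrow> cpoly" where
  "polar i j = derivation (\<lambda>(k, t). if j = k then pvar i t else 0)"

lemma polar_pvar: "polar i j (pvar k t) = (if j = k then pvar i t else 0)"
  by (simp add: polar_def derivation_pvar)

fun letter_act :: "('a, 'b) symb \<times> ('a, 'b) symb \<Rightarrow> cpoly \<Rightarrow> cpoly" where
  "letter_act (Prop i, Prop j) p = polar i j p"
| "letter_act _ p = 0"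

definition tens_act :: "('a, 'b) talg \<Rightarrow> cpoly \<Rightarrow> cpoly" where
  "tens_act f p =
     (\<Sum>w \<in> Poly_Mapping.keys f. scal (Poly_Mapping.lookup f w) * foldr letter_act (mletters w) p)"

text \<open>An element \<open>u\<close> of \<open>\<^bold>U(gl(n))\<close> is a coset which contains noncommutative polynomials in the
  \<open>e\<^sub>i\<^sub>j\<close> with \<open>i, j \<in> \<L>\<close>; all of these induce the same operator, which is the action of \<open>u\<close>.\<close>

definition gl_act :: "nat \<Rightarrow> nat \<Rightarrow> ('a, 'b) talg set \<Rightarrow> cpoly \<Rightarrow> cpoly" where
  "gl_act n d u = (\<lambda>p \<in> poly_M n d.
     the_elem ((\<lambda>f. tens_act f p) ` (u \<inter> carrier (tens (propers n)))))"


section \<open>Partitions, highest weight vectors and vertical strips\<close>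

definition is_partition :: "nat list \<Rightarrow> bool" where
  "is_partition \<mu> \<longleftrightarrow> sorted_wrt (\<ge>) \<mu> \<and> 0 \<notin> set \<mu>"

definition first_part :: "nat list \<Rightarrow> nat" where
  "first_part \<mu> = (case \<mu> of [] \<Rightarrow> 0 | m # _ \<Rightarrow> m)"

text \<open>The product of the minors \<open>det [(s|t)]\<^bsub>s,t = 1,\<dots>,\<mu>\<^sub>r\<^esub>\<close>, without the sign by which it may
  differ from the canonical highest weight vector.\<close>

definition hw_prod :: "nat list \<Rightarrow> cpoly" where
  "hw_prod \<mu> = (\<Prod>r < length \<mu>. det (mat (\<mu> ! r) (\<mu> ! r) (\<lambda>(s, t). pvar (Suc s) (Suc t))))"

text \<open>Cells are (row, column), both counted from 0.\<close>

definition ferrers :: "nat list \<Rightarrow> (nat \<times> nat) set" where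
  "ferrers \<mu> = {(r, c). r < length \<mu> \<and> c < \<mu> ! r}"

definition vstrips :: "nat list \<Rightarrow> nat \<Rightarrow> (nat \<times> nat) set set" where
  "vstrips \<mu> k = {V. V \<subseteq> ferrers \<mu> \<and> card V = k \<and> inj_on fst V}"

definition vstrip_fact :: "(nat \<times> nat) set \<Rightarrow> nat" where
  "vstrip_fact V = (\<Prod>c \<in> snd ` V. fact (card {x \<in> V. snd x = c}))"

end

theory Submission
  imports Defs
begin

text \<open>
  The superalgebra acts by superderivations on the tensor algebra over the letters \<open>(a, t)\<close>, and every
  irregular product kills the tensors in the proper letters: some virtual symbol is annihilated before
  it has been created. Hence the action of a devirtualized element on such tensors may be computed
  with the virtual element itself. Mapping tensors in the proper letters and \<open>\<beta>\<close> to polynomials turns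
  the generators into polarizations. Applied to a product of minors, the operators \<open>e\<^sub>\<beta>\<^sub>i\<close> replace
  row \<open>i\<close> by row \<open>\<beta>\<close> in all possible ways, at most once in each minor, so that the terms are indexed by
  vertical strips. The operators \<open>e\<^sub>i\<^sub>\<beta>\<close>, applied for increasing \<open>i\<close>, must restore the rows: any other
  substitution creates two equal rows. The factorials count the orders in which the cells of
  a column of the strip are created and restored.
\<close>

section \<open>Polarizations of products of minors\<close>

text \<open>\<open>devirt\<close> and \<open>gl_act\<close> are given by \<open>SOME\<close> and
  \<open>the_elem\<close>, and this shapes the proof. A value of \<open>devirt\<close> carries
  information only on \<open>Virt\<close>, so the Nazarov words must be shown to lie there; this
  holds for every word over \<beta> and the proper symbols in which \<beta> is created as often as
  it is annihilated. Moreover the operator attached to a class must depend neither on the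
  representative nor on the chosen element. One representation \<open>rep\<close> settles both: it
  kills \<open>env_ideal\<close> of the full superalgebra and, on tensors without virtual symbols,
  also \<open>Irr\<close>, so all admissible choices act alike. Tensors form a free algebra, where
  no supercommutation relations have to be respected; since Nazarov words contain only symbols of
  parity 1, their signs vanish and commuting variables can take over.\<close>

lemma polar_add: "polar i j (p + q) = polar i j p + polar i j q"
  by (simp add: polar_def derivation_add)

lemma polar_mult: "polar i j (p * q) = polar i j p * q + p * polar i j q"
  by (simp add: polar_def derivation_mult)

lemma polar_single_0 [simp]: "polar i j (Poly_Mapping.single 0 c) = 0"
  by (simp add: polar_def derivation_def)

lemma polar_0 [simp]: "polar i j 0 = 0"
  using polar_single_0[of i j 0] by simp

lemma polar_1 [simp]: "polar i j 1 = 0"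
  using polar_single_0[of i j 1] by simp

lemma polar_scal: "polar i j (scal c * p) = scal c * polar i j p"
  by (simp add: polar_mult scal_def)

lemma polar_of_nat: "polar i j (of_nat k * p) = of_nat k * polar i j p"
  by (simp add: polar_mult single_of_nat[symmetric] del: single_of_nat)

lemma polar_of_int: "polar i j (of_int k * p) = of_int k * polar i j p"
  by (simp add: polar_mult single_of_int[symmetric] del: single_of_int)

lemma polar_sum: "polar i j (\<Sum>x\<in>A. f x) = (\<Sum>x\<in>A. polar i j (f x))"
  by (induction A rule: infinite_finite_induct) (simp_all add: polar_add)

text \<open>Leibniz rule for products. Writing each summand with a function update keeps it a
  product over the same index set, so that it can be read again as a product of variables or of
  minors with one factor changed.\<close>

lemma polar_prod:
  assumes "finite A"
  shows "polar i j (\<Prod>x\<in>A. f x) = (\<Sum>x\<in>A. \<Prod>y\<in>A. (f(x := polar i j (f x))) y)"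
  using assms
proof (induction A)
  case (insert a A)
  have "(\<Sum>x\<in>A. \<Prod>y\<in>insert a A. (f(x := polar i j (f x))) y) =
    f a * (\<Sum>x\<in>A. \<Prod>y\<in>A. (f(x := polar i j (f x))) y)"
    unfolding sum_distrib_left using insert.hyps by (intro sum.cong refl) auto
  moreover have "(\<Prod>y\<in>insert a A. (f(a := polar i j (f a))) y) = polar i j (f a) * (\<Prod>x\<in>A. f x)"
  proof -
    have "(\<Prod>y\<in>A. (f(a := polar i j (f a))) y) = (\<Prod>y\<in>A. f y)"
      using insert.hyps by (intro prod.cong) auto
    then show ?thesis using insert.hyps by (simp del: fun_upd_apply) simp
  qed
  ultimately show ?case
    using insert by (simp add: polar_mult sum.insert del: fun_upd_apply prod.insert) (simp add: polar_mult)
qed simp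

section \<open>Minors with arbitrary row labels\<close>

definition minor :: "nat \<Rightarrow> (nat \<Rightarrow> nat) \<Rightarrow> cpoly" where
  "minor m f = det (mat m m (\<lambda>(s, t). pvar (f s) (Suc t)))"

lemma minor_alt: "minor m f =
  (\<Sum>p | p permutes {0..<m}. of_int (sign p) * (\<Prod>s\<in>{0..<m}. pvar (f s) (Suc (p s))))"
  unfolding minor_def det_def by (auto intro!: sum.cong prod.cong simp: permutes_in_image[of _ "{0..<m}", simplified])

lemma minor_cong: "(\<And>s. s < m \<Longrightarrow> f s = g s) \<Longrightarrow> minor m f = minor m g"
  by (auto simp: minor_alt intro!: sum.cong prod.cong)

lemma minor_eq_0: "s \<noteq> s' \<Longrightarrow> s < m \<Longrightarrow> s' < m \<Longrightarrow> f s = f s' \<Longrightarrow> minor m f = 0"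
  unfolding minor_def by (rule det_identical_rows[of _ m s s']) auto

text \<open>Every monomial of the expansion has exactly one factor from each row. Replacing that
  factor in all monomials at once relabels the row, so the sum over permutations can be exchanged
  with the sum over the rows labelled \<open>j\<close>.\<close>

lemma polar_minor: "polar i j (minor m f) = (\<Sum>s | s < m \<and> f s = j. minor m (f(s := i)))"
proof -
  let ?S = "{s. s < m \<and> f s = j}"
  have "polar i j (\<Prod>s\<in>{0..<m}. pvar (f s) (Suc (p s))) =
    (\<Sum>s\<in>?S. \<Prod>y\<in>{0..<m}. pvar ((f(s := i)) y) (Suc (p y)))" for p
  proof -
    have "polar i j (\<Prod>s\<in>{0..<m}. pvar (f s) (Suc (p s))) = (\<Sum>s\<in>{0..<m}. \<Prod>y\<in>{0..<m}.
       ((\<lambda>s. pvar (f s) (Suc (p s)))(s := polar i j (pvar (f s) (Suc (p s))))) y)"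
      by (simp only: polar_prod finite_atLeastLessThan)
    also have "\<dots> = (\<Sum>s\<in>{0..<m}. if f s = j then
        \<Prod>y\<in>{0..<m}. pvar ((f(s := i)) y) (Suc (p y)) else 0)"
      by (intro sum.cong refl) (auto simp: polar_pvar intro!: prod.cong prod_zero)
    also have "\<dots> = (\<Sum>s\<in>?S. \<Prod>y\<in>{0..<m}. pvar ((f(s := i)) y) (Suc (p y)))"
      by (intro sum.mono_neutral_cong_right) auto
    finally show ?thesis .
  qed
  then show ?thesis
    unfolding minor_alt polar_sum polar_of_int by (simp add: sum_distrib_left) (rule sum.swap)
qed

text \<open>The label function is a filling of the Ferrers diagram: row \<open>r\<close> of the
  diagram lists the row labels of the \<open>r\<close>-th minor. A cell thus stands for a matrix
  row, and polarization acts on single cells.\<close>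

definition minors :: "nat list \<Rightarrow> (nat \<times> nat \<Rightarrow> nat) \<Rightarrow> cpoly" where
  "minors \<mu> f = (\<Prod>r < length \<mu>. minor (\<mu> ! r) (\<lambda>s. f (r, s)))"

lemma minors_cong: "(\<And>x. x \<in> ferrers \<mu> \<Longrightarrow> f x = g x) \<Longrightarrow> minors \<mu> f = minors \<mu> g"
  by (auto simp: minors_def ferrers_def intro!: prod.cong minor_cong)

lemma minors_eq_0:
  "(r, s) \<in> ferrers \<mu> \<Longrightarrow> (r, s') \<in> ferrers \<mu> \<Longrightarrow> s \<noteq> s' \<Longrightarrow> f (r, s) = f (r, s') \<Longrightarrow> minors \<mu> f = 0"
  unfolding minors_def ferrers_def
  by (auto intro!: prod_zero bexI[of _ r] minor_eq_0[of s s'])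

lemma finite_ferrers [simp]: "finite (ferrers \<mu>)"
proof -
  have "ferrers \<mu> = Sigma {..<length \<mu>} (\<lambda>r. {..<\<mu> ! r})" by (auto simp: ferrers_def)
  then show ?thesis by simp
qed

text \<open>Leibniz rule twice, across the factors and then across the rows of one factor; the pairs
  of a factor and a row labelled \<open>j\<close> are the cells with that label.\<close>

lemma polar_minors:
  "polar i j (minors \<mu> f) = (\<Sum>x | x \<in> ferrers \<mu> \<and> f x = j. minors \<mu> (f(x := i)))"
proof -
  let ?L = "{..<length \<mu>}"
  let ?S = "\<lambda>r. {s. s < \<mu> ! r \<and> f (r, s) = j}"
  have "polar i j (minors \<mu> f) = (\<Sum>r\<in>?L. \<Prod>y\<in>?L.
      ((\<lambda>r. minor (\<mu> ! r) (\<lambda>s. f (r, s)))(r := polar i j (minor (\<mu> ! r) (\<lambda>s. f (r, s))))) y)"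
    unfolding minors_def by (simp only: polar_prod finite_lessThan)
  also have "\<dots> = (\<Sum>r\<in>?L. \<Sum>s\<in>?S r. minors \<mu> (f((r, s) := i)))"
  proof (intro sum.cong refl)
    fix r assume r: "r \<in> ?L"
    let ?m = "\<lambda>r. minor (\<mu> ! r) (\<lambda>s. f (r, s))"
    have "(\<Prod>y\<in>?L. (?m(r := polar i j (?m r))) y) = polar i j (?m r) * (\<Prod>y\<in>?L - {r}. ?m y)"
      using r by (subst prod.remove[of _ r]) auto
    also have "\<dots> = (\<Sum>s\<in>?S r. minor (\<mu> ! r) ((\<lambda>s. f (r, s))(s := i)) * (\<Prod>y\<in>?L - {r}. ?m y))"
      by (simp add: polar_minor sum_distrib_right)
    also have "\<dots> = (\<Sum>s\<in>?S r. minors \<mu> (f((r, s) := i)))"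
      unfolding minors_def using r
      by (intro sum.cong refl, subst prod.remove[of ?L r])
         (auto intro!: arg_cong2[of _ _ _ _ "(*)"] minor_cong prod.cong)
    finally show "(\<Prod>y\<in>?L. (?m(r := polar i j (?m r))) y) = (\<Sum>s\<in>?S r. minors \<mu> (f((r, s) := i)))" .
  qed
  also have "\<dots> = (\<Sum>x\<in>Sigma ?L ?S. minors \<mu> (f(x := i)))"
    by (subst sum.Sigma) (auto intro!: sum.cong)
  also have "Sigma ?L ?S = {x \<in> ferrers \<mu>. f x = j}"
    by (auto simp: ferrers_def)
  finally show ?thesis .
qed

section \<open>Cells marked by \<beta>\<close>

definition marked :: "nat list \<Rightarrow> (nat \<times> nat) set \<Rightarrow> cpoly" where
  "marked \<mu> V = minors \<mu> (\<lambda>x. if x \<in> V then 0 else Suc (snd x))"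

lemma marked_empty: "marked \<mu> {} = hw_prod \<mu>"
  by (simp add: marked_def minors_def minor_def hw_prod_def)

text \<open>The label 0 stands for \<beta>, so two marked cells in one row of the diagram give a
  minor with two equal rows. This is where the condition defining vertical strips comes
  from.\<close>

lemma marked_eq_0:
  assumes "V \<subseteq> ferrers \<mu>" "\<not> inj_on fst V"
  shows "marked \<mu> V = 0"
proof -
  obtain r s s' where "(r, s) \<in> V" "(r, s') \<in> V" "s \<noteq> s'"
    using assms(2) unfolding inj_on_def by (metis prod.collapse)
  then show ?thesis
    unfolding marked_def using assms(1) by (intro minors_eq_0[of r s \<mu> s']) auto
qed

lemma polar_marked_create:
  "polar 0 (Suc c) (marked \<mu> V) = (\<Sum>x | x \<in> ferrers \<mu> - V \<and> snd x = c. marked \<mu> (insert x V))"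
  unfolding marked_def polar_minors by (intro sum.cong minors_cong) auto

text \<open>Relabelling a marked cell of column \<open>c\<close> restores its canonical label. For a
  marked cell \<open>(r, s)\<close> with \<open>c < s\<close>, the cell \<open>(r, c)\<close> also
  lies in the diagram, is unmarked because row \<open>r\<close> has only one marked cell, and
  already carries \<open>Suc c\<close>; so two rows of a minor coincide. For \<open>s < c\<close>
  the cell \<open>(r, c)\<close> could be missing from the diagram, and the last hypothesis excludes
  this case; the order of the operators will provide it.\<close>

lemma polar_marked_annihilate:
  assumes V: "V \<subseteq> ferrers \<mu>" "inj_on fst V" and c: "\<And>x. x \<in> V \<Longrightarrow> c \<le> snd x"
  shows "polar (Suc c) 0 (marked \<mu> V) = (\<Sum>x | x \<in> V \<and> snd x = c. marked \<mu> (V - {x}))"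
proof -
  let ?f = "\<lambda>x. if x \<in> V then 0 else Suc (snd x)"
  have "polar (Suc c) 0 (marked \<mu> V) = (\<Sum>x\<in>V. minors \<mu> (?f(x := Suc c)))"
    unfolding marked_def polar_minors using V by (intro sum.cong) auto
  also have "\<dots> = (\<Sum>x | x \<in> V \<and> snd x = c. marked \<mu> (V - {x}))"
  proof (rule sum.mono_neutral_cong_right)
    show "finite V" using V finite_subset[OF _ finite_ferrers] by blast
    show "\<forall>x\<in>V - {x. x \<in> V \<and> snd x = c}. minors \<mu> (?f(x := Suc c)) = 0"
    proof
      fix x assume x: "x \<in> V - {x. x \<in> V \<and> snd x = c}"
      obtain r s where rs: "x = (r, s)" by force
      have "c < s" using x c[of x] rs by auto
      moreover have "(r, c) \<notin> V"
        using inj_onD[OF V(2), of "(r, s)" "(r, c)"] x rs by auto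
      ultimately show "minors \<mu> (?f(x := Suc c)) = 0"
        using V(1) x rs by (intro minors_eq_0[of r s \<mu> c]) (auto simp: ferrers_def)
    qed
    show "minors \<mu> (?f(x := Suc c)) = marked \<mu> (V - {x})" if "x \<in> {x. x \<in> V \<and> snd x = c}" for x
      unfolding marked_def using that by (intro minors_cong) auto
  qed auto
  finally show ?thesis .
qed

section \<open>Creating and removing marks, counted by columns\<close>

definition col_card :: "(nat \<times> nat) set \<Rightarrow> nat \<Rightarrow> nat" where
  "col_card V i = card {x \<in> V. Suc (snd x) = i}"

lemma col_card_insert:
  assumes "finite V" "x \<notin> V"
  shows "col_card (insert x V) i = (if i = Suc (snd x) then Suc (col_card V i) else col_card V i)"
proof -
  have "{y \<in> insert x V. Suc (snd y) = i} =
    (if i = Suc (snd x) then insert x {y \<in> V. Suc (snd y) = i} else {y \<in> V. Suc (snd y) = i})"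
    by auto
  then show ?thesis using assms by (auto simp: col_card_def)
qed

lemma col_card_remove:
  assumes "finite V" "x \<in> V"
  shows "col_card V i = (if i = Suc (snd x) then Suc (col_card (V - {x}) i) else col_card (V - {x}) i)"
  using col_card_insert[of "V - {x}" x i] assms by (simp add: insert_absorb)

text \<open>Induction on the word. One more \<open>polar 0 (Suc c)\<close> passes from
  \<open>V\<close> to \<open>insert x V\<close> for a new cell \<open>x\<close> of column
  \<open>c\<close>, and a set with \<open>m\<close> marks in that column is reached in
  \<open>m\<close> ways, which turns \<open>fact (m - 1)\<close> into \<open>fact m\<close>. All
  subsets of the diagram with the right column counts are kept here; those that are not strips are
  discarded later.\<close>

lemma foldr_create:
  assumes "set is \<subseteq> {1..n}"
  shows "foldr (polar 0) is (hw_prod \<mu>) = of_nat (\<Prod>i = 1..n. fact (count_list is i)) *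
           (\<Sum>V | V \<subseteq> ferrers \<mu> \<and> col_card V = count_list is. marked \<mu> V)"
  using assms
proof (induction "is")
  case Nil
  have "V = {}" if V: "V \<subseteq> ferrers \<mu>" "col_card V = count_list []" for V
  proof (rule ccontr)
    assume "V \<noteq> {}"
    then obtain x where "x \<in> V" by blast
    moreover have "finite V" using V finite_subset[OF _ finite_ferrers] by blast
    ultimately show False
      using fun_cong[OF V(2), of "Suc (snd x)"] col_card_remove[of V x] by auto
  qed
  then have *: "{V. V \<subseteq> ferrers \<mu> \<and> col_card V = count_list []} = {{}}"
    by (auto simp: col_card_def fun_eq_iff)
  show ?case unfolding * by (simp add: marked_empty)
next
  case (Cons j js)
  then obtain c where c: "j = Suc c" by (cases j) auto
  let ?C = "\<lambda>is. {V. V \<subseteq> ferrers \<mu> \<and> col_card V = count_list is}"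
  have fin: "finite (?C is)" for "is" by (rule finite_subset[of _ "Pow (ferrers \<mu>)"]) auto
  have finV: "finite V" if "V \<subseteq> ferrers \<mu>" for V using that finite_subset[OF _ finite_ferrers] by blast
  have "polar 0 j (\<Sum>V\<in>?C js. marked \<mu> V) =
    (\<Sum>V\<in>?C js. \<Sum>x | x \<in> ferrers \<mu> - V \<and> snd x = c. marked \<mu> (insert x V))"
    by (simp add: polar_sum polar_marked_create c)
  also have "\<dots> = (\<Sum>(V, x)\<in>(SIGMA V:?C js. {x. x \<in> ferrers \<mu> - V \<and> snd x = c}). marked \<mu> (insert x V))"
    by (rule sum.Sigma) (use fin in auto)
  \<comment> \<open>Double counting: a set with a new cell chosen outside it corresponds to the
    enlarged set with one of its cells of column \<open>c\<close> singled out.\<close>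
  also have "\<dots> = (\<Sum>(V, x)\<in>(SIGMA V:?C (j # js). {x. x \<in> V \<and> snd x = c}). marked \<mu> V)"
    by (rule sum.reindex_bij_witness
          [of _ "\<lambda>(V, x). (V - {x}, x)" "\<lambda>(V, x). (insert x V, x)"])
       (auto simp: c insert_absorb finV col_card_insert fun_eq_iff col_card_remove[OF finV] split: if_splits)
  also have "\<dots> = (\<Sum>V\<in>?C (j # js). \<Sum>x | x \<in> V \<and> snd x = c. marked \<mu> V)"
    by (rule sum.Sigma[symmetric]) (use fin finV in auto)
  also have "\<dots> = (\<Sum>V\<in>?C (j # js). of_nat (Suc (count_list js j)) * marked \<mu> V)"
  proof (intro sum.cong refl)
    fix V assume V: "V \<in> ?C (j # js)"
    have "card {x. x \<in> V \<and> snd x = c} = count_list (j # js) j"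
      using V fun_cong[of "col_card V" "count_list (j # js)" j] unfolding col_card_def c by simp
    then show "(\<Sum>x | x \<in> V \<and> snd x = c. marked \<mu> V) = of_nat (Suc (count_list js j)) * marked \<mu> V"
      by simp
  qed
  finally have *: "polar 0 j (\<Sum>V\<in>?C js. marked \<mu> V) =
      of_nat (Suc (count_list js j)) * (\<Sum>V\<in>?C (j # js). marked \<mu> V)"
    by (simp add: sum_distrib_left)
  have **: "(\<Prod>i = 1..n. fact (count_list (j # js) i)) =
      Suc (count_list js j) * (\<Prod>i = 1..n. fact (count_list js i) :: nat)"
  proof -
    have j: "j \<in> {1..n}" using Cons.prems by simp
    have count: "count_list (j # js) j = Suc (count_list js j)" by simp
    have rest: "(\<Prod>i\<in>{1..n} - {j}. fact (count_list (j # js) i)) =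
      (\<Prod>i\<in>{1..n} - {j}. fact (count_list js i) :: nat)" by (intro prod.cong) auto
    have "(\<Prod>i = 1..n. fact (count_list (j # js) i)) =
        (fact (count_list (j # js) j) * (\<Prod>i\<in>{1..n} - {j}. fact (count_list (j # js) i)) :: nat)"
      by (rule prod.remove) (use j in auto)
    also have "\<dots> = Suc (count_list js j) *
        (fact (count_list js j) * (\<Prod>i\<in>{1..n} - {j}. fact (count_list js i)))"
      unfolding rest count fact_Suc of_nat_id mult.assoc ..
    also have "fact (count_list js j) * (\<Prod>i\<in>{1..n} - {j}. fact (count_list js i)) =
        (\<Prod>i = 1..n. fact (count_list js i) :: nat)"
      by (rule prod.remove[symmetric]) (use j in auto)
    finally show ?thesis .
  qed
  let ?p = "\<lambda>js. (\<Prod>i = 1..n. fact (count_list js i)) :: nat"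
  have "set js \<subseteq> {1..n}" using Cons.prems by simp
  note IH = Cons.IH[OF this]
  have "foldr (polar 0) (j # js) (hw_prod \<mu>) = polar 0 j (of_nat (?p js) * (\<Sum>V\<in>?C js. marked \<mu> V))"
    unfolding foldr_Cons o_apply IH ..
  also have "\<dots> = of_nat (?p js) * (of_nat (Suc (count_list js j)) * (\<Sum>V\<in>?C (j # js). marked \<mu> V))"
    unfolding polar_of_nat * ..
  also have "\<dots> = of_nat (?p (j # js)) * (\<Sum>V\<in>?C (j # js). marked \<mu> V)"
    unfolding ** of_nat_mult mult.assoc by (rule mult.left_commute)
  finally show ?case .
qed

text \<open>Each application clears one of the remaining marks of column \<open>c\<close>. Whatever
  the order, the same set is left, so the number of orders, a factorial, appears as
  coefficient.\<close>

lemma polar_annihilate_power: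
  assumes "V \<subseteq> ferrers \<mu>" "inj_on fst V" "\<And>x. x \<in> V \<Longrightarrow> c \<le> snd x"
  shows "(polar (Suc c) 0 ^^ col_card V (Suc c)) (marked \<mu> V) =
           of_nat (fact (col_card V (Suc c))) * marked \<mu> {x \<in> V. c < snd x}"
  using assms
proof (induction "col_card V (Suc c)" arbitrary: V)
  case 0
  have finV: "finite V" using 0 finite_subset[OF _ finite_ferrers] by blast
  have "{x \<in> V. Suc (snd x) = Suc c} = {}"
    using 0(1) card_0_eq[of "{x \<in> V. Suc (snd x) = Suc c}"] finV unfolding col_card_def by auto
  then have "c \<noteq> snd x" if "x \<in> V" for x
    using that by blast
  then have "c < snd x" if "x \<in> V" for x
    using that "0.prems"(3)[OF that] by (simp add: le_less)
  then have "{x \<in> V. c < snd x} = V" by auto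
  then show ?case unfolding 0(1)[symmetric] by simp
next
  case (Suc k V)
  have finV: "finite V" using Suc.prems finite_subset[OF _ finite_ferrers] by blast
  have pn: "(polar (Suc c) 0 ^^ k) (\<Sum>x\<in>A. g x) = (\<Sum>x\<in>A. (polar (Suc c) 0 ^^ k) (g x))"
    for A :: "(nat \<times> nat) set" and g and k by (induction k) (simp_all add: polar_sum)
  \<comment> \<open>\<open>funpow_swap1\<close> exposes the application that acts first; the
    remaining \<open>k\<close> fall under the induction hypothesis.\<close>
  have "(polar (Suc c) 0 ^^ Suc k) (marked \<mu> V) =
    (\<Sum>x | x \<in> V \<and> snd x = c. (polar (Suc c) 0 ^^ k) (marked \<mu> (V - {x})))"
    using Suc.prems by (simp add: funpow_swap1 polar_marked_annihilate pn)
  also have "\<dots> = (\<Sum>x | x \<in> V \<and> snd x = c. of_nat (fact k) * marked \<mu> {x \<in> V. c < snd x})"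
  proof (intro sum.cong refl)
    fix x assume x: "x \<in> {x. x \<in> V \<and> snd x = c}"
    have k: "k = col_card (V - {x}) (Suc c)"
      using Suc(2) x finV col_card_remove[of V x "Suc c"] by auto
    have "{y \<in> V - {x}. c < snd y} = {x \<in> V. c < snd x}" using x by auto
    then show "(polar (Suc c) 0 ^^ k) (marked \<mu> (V - {x})) = of_nat (fact k) * marked \<mu> {x \<in> V. c < snd x}"
      using Suc(1)[OF k] Suc.prems k by (auto simp: inj_on_diff)
  qed
  also have "\<dots> = of_nat (Suc k) * (of_nat (fact k) * marked \<mu> {x \<in> V. c < snd x})"
    using Suc(2) by (simp add: col_card_def)
  finally show ?case unfolding Suc(2)[symmetric] fact_Suc of_nat_mult mult.assoc of_nat_id .
qed

text \<open>\<open>foldr\<close> lets the last letter act first, so the reversed list treats the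
  columns from left to right. When column \<open>m\<close> is reached, all marks further left are
  gone, and this is exactly the hypothesis of \<open>polar_annihilate_power\<close>.\<close>

lemma foldr_annihilate:
  assumes "V \<subseteq> ferrers \<mu>" "inj_on fst V"
  shows "foldr (\<lambda>i. polar i 0) (concat (map (\<lambda>i. replicate (col_card V i) i) (rev [1..<Suc m]))) (marked \<mu> V) =
           of_nat (\<Prod>i = 1..m. fact (col_card V i)) * marked \<mu> {x \<in> V. m \<le> snd x}"
proof (induction m)
  case (Suc m)
  let ?W = "{x \<in> V. m \<le> snd x}"
  have pn: "(polar (Suc m) 0 ^^ k) (of_nat j * p) = of_nat j * (polar (Suc m) 0 ^^ k) p" for j k p
    by (induction k) (simp_all add: polar_of_nat)
  have eq: "col_card V (Suc m) = col_card ?W (Suc m)"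
    unfolding col_card_def by (rule arg_cong[of _ _ card]) auto
  have sub: "{x \<in> ?W. m < snd x} = {x \<in> V. Suc m \<le> snd x}" by auto
  have W: "(polar (Suc m) 0 ^^ col_card V (Suc m)) (marked \<mu> ?W) =
    of_nat (fact (col_card V (Suc m))) * marked \<mu> {x \<in> V. Suc m \<le> snd x}"
  proof (rule polar_annihilate_power[of ?W \<mu> m, unfolded sub eq[symmetric]])
    show "inj_on fst ?W" using assms(2) by (rule inj_on_subset) blast
  qed (use assms(1) in blast)+
  have prod: "(\<Prod>i = 1..Suc m. fact (col_card V i)) =
    (\<Prod>i = 1..m. fact (col_card V i)) * (fact (col_card V (Suc m)) :: nat)"
    by (subst prod.cl_ivl_Suc) simp
  have rev: "rev [1..<Suc (Suc m)] = Suc m # rev [1..<Suc m]"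
    by simp
  show ?case
    unfolding rev list.map concat.simps foldr_append foldr_replicate Suc.IH pn W prod of_nat_mult mult.assoc ..
qed simp

lemma finite_compositions: "finite {h \<in> {1..n::nat} \<rightarrow>\<^sub>E UNIV. (\<Sum>i = 1..n. h i) = (k::nat)}"
proof (rule finite_subset)
  show "{h \<in> {1..n} \<rightarrow>\<^sub>E UNIV. (\<Sum>i = 1..n. h i) = k} \<subseteq> {1..n} \<rightarrow>\<^sub>E {..k}"
    unfolding PiE_def by (auto intro!: member_le_sum)
qed (simp add: finite_PiE)

text \<open>Marking the cells contributes the product of the \<open>fact (h i)\<close>, which the
  coefficient in the Nazarov element cancels; unmarking them contributes it once more, and this copy
  survives. Since \<open>h\<close> consists of the column counts of the strip, the sum over
  \<open>h\<close> and \<open>V\<close> is a single sum over strips.\<close>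

lemma sum_nazarov_polar:
  assumes parts: "\<And>x. x \<in> ferrers \<mu> \<Longrightarrow> snd x < n"
  defines "H \<equiv> \<lambda>k. {h \<in> {1..n} \<rightarrow>\<^sub>E UNIV. (\<Sum>i = 1..n. h i) = k}"
  defines "is \<equiv> (\<lambda>h ns. concat (map (\<lambda>i. replicate (h i) i) ns))"
  shows "(\<Sum>h\<in>H k. scal (1 / (\<Prod>i = 1..n. fact (h i))) *
            foldr (\<lambda>i. polar i 0) (is h (rev [1..<Suc n])) (foldr (polar 0) (is h [1..<Suc n]) (hw_prod \<mu>))) =
         of_nat (\<Sum>V\<in>vstrips \<mu> k. vstrip_fact V) * hw_prod \<mu>"
proof -
  note upt_Suc [simp del] One_nat_def [simp del]
  have finV: "finite V" if "V \<subseteq> ferrers \<mu>" for V using that finite_subset[OF _ finite_ferrers] by blast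
  \<comment> \<open>No cell lies beyond the \<open>n\<close>-th column, so agreement of column
    counts on \<open>{1..n}\<close> is agreement everywhere.\<close>
  have col0: "col_card V i = 0" if V: "V \<subseteq> ferrers \<mu>" and i: "i \<notin> {1..n}" for V i
  proof -
    have "Suc (snd x) \<noteq> i" if "x \<in> V" for x
      using parts[of x] that V i by auto
    then have "{x \<in> V. Suc (snd x) = i} = {}" by blast
    then show ?thesis unfolding col_card_def by (simp only: card.empty)
  qed
  have cols: "Suc (snd x) \<in> {1..n}" if "V \<subseteq> ferrers \<mu>" "x \<in> V" for V x
    using that parts[of x] by auto
  have card: "(\<Sum>i = 1..n. col_card V i) = card V" if V: "V \<subseteq> ferrers \<mu>" for V
  proof -
    have "card V = (\<Sum>i = 1..n. \<Sum>x\<in>{x \<in> V. Suc (snd x) = i}. 1)"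
      unfolding card_eq_sum using finV[OF V] cols[OF V] by (intro sum.group[symmetric]) auto
    then show ?thesis by (simp add: col_card_def)
  qed
  have fs: "foldr (\<lambda>i. polar i 0) w (\<Sum>x\<in>A. g x) = (\<Sum>x\<in>A. foldr (\<lambda>i. polar i 0) w (g x))"
    for w and A :: "(nat \<times> nat) set set" and g by (induction w) (simp_all add: polar_sum)
  have fn: "foldr (\<lambda>i. polar i 0) w (of_nat j * p) = of_nat j * foldr (\<lambda>i. polar i 0) w p" for w j p
    by (induction w) (simp_all add: polar_of_nat)
  let ?C = "\<lambda>h. {V. V \<subseteq> ferrers \<mu> \<and> (\<forall>i\<in>{1..n}. col_card V i = h i)}"
  let ?D = "\<lambda>h. {V \<in> ?C h. inj_on fst V}"
  have finC: "finite (?C h)" for h by (rule finite_subset[of _ "Pow (ferrers \<mu>)"]) auto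
  have rep: "count_list (replicate m j) i = (if j = i then m else 0)" for m i j :: nat
    by (induction m) auto
  have count: "count_list (is h [1..<Suc n]) i = (if i \<in> {1..n} then h i else 0)" for h i
  proof -
    have "count_list (is h [1..<Suc n]) i = (\<Sum>j = 1..n. if j = i then h j else 0)"
      unfolding is_def count_list_concat
      by (simp add: sum_list_distinct_conv_sum_set atLeastLessThanSuc_atLeastAtMost o_def rep del: upt_Suc)
    then show ?thesis by (simp add: sum.delta)
  qed
  have H: "finite (H k)"
    unfolding H_def by (rule finite_compositions)
  have "scal (1 / (\<Prod>i = 1..n. fact (h i))) *
          foldr (\<lambda>i. polar i 0) (is h (rev [1..<Suc n])) (foldr (polar 0) (is h [1..<Suc n]) (hw_prod \<mu>)) =
        (\<Sum>V\<in>?D h. of_nat (\<Prod>i = 1..n. fact (col_card V i)) * hw_prod \<mu>)" (is "?l = ?r") for h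
  proof -
    let ?P = "(\<Prod>i = 1..n. fact (h i)) :: nat"
    have "set (is h [1..<Suc n]) \<subseteq> {1..n}" by (auto simp: is_def)
    then have "foldr (polar 0) (is h [1..<Suc n]) (hw_prod \<mu>) =
      of_nat (\<Prod>i = 1..n. fact (count_list (is h [1..<Suc n]) i)) *
      (\<Sum>V | V \<subseteq> ferrers \<mu> \<and> col_card V = count_list (is h [1..<Suc n]). marked \<mu> V)"
      by (rule foldr_create)
    also have "{V. V \<subseteq> ferrers \<mu> \<and> col_card V = count_list (is h [1..<Suc n])} = ?C h"
      using col0 by (auto simp: fun_eq_iff count)
    also have "(\<Prod>i = 1..n. fact (count_list (is h [1..<Suc n]) i)) = ?P"
      by (intro prod.cong) (auto simp: count)
    finally have create: "foldr (polar 0) (is h [1..<Suc n]) (hw_prod \<mu>) =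
      of_nat ?P * (\<Sum>V\<in>?C h. marked \<mu> V)" .
    have "scal (1 / (\<Prod>i = 1..n. fact (h i))) * of_nat ?P = (1 :: cpoly)"
      unfolding scal_def single_of_nat[symmetric] mult_single by simp
    then have "?l = (\<Sum>V\<in>?C h. foldr (\<lambda>i. polar i 0) (is h (rev [1..<Suc n])) (marked \<mu> V))"
      unfolding create fn fs mult.assoc[symmetric] by (simp only: mult_1)
    also have "(\<Sum>V\<in>?C h. foldr (\<lambda>i. polar i 0) (is h (rev [1..<Suc n])) (marked \<mu> V)) = ?r"
    proof (rule sum.mono_neutral_cong_right)
      show "\<forall>V\<in>?C h - ?D h. foldr (\<lambda>i. polar i 0) (is h (rev [1..<Suc n])) (marked \<mu> V) = 0"
      proof
        fix V assume "V \<in> ?C h - ?D h"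
        then have "marked \<mu> V = 0" by (intro marked_eq_0) auto
        then show "foldr (\<lambda>i. polar i 0) (is h (rev [1..<Suc n])) (marked \<mu> V) = 0"
          using fn[of _ 0] by simp
      qed
    next
      fix V assume V: "V \<in> ?D h"
      have word: "is h (rev [1..<Suc n]) = concat (map (\<lambda>i. replicate (col_card V i) i) (rev [1..<Suc n]))"
        unfolding is_def using V by (intro arg_cong[of _ _ concat] map_cong) auto
      \<comment> \<open>After all \<open>n\<close> columns have been treated no mark is left, so the
        highest weight vector is recovered.\<close>
      have empty: "{x \<in> V. n \<le> snd x} = {}" using V parts by fastforce
      show "foldr (\<lambda>i. polar i 0) (is h (rev [1..<Suc n])) (marked \<mu> V) =
          of_nat (\<Prod>i = 1..n. fact (col_card V i)) * hw_prod \<mu>"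
        using V foldr_annihilate[of V \<mu> n] unfolding word empty marked_empty by simp
    qed (use finC in auto)
    finally show ?thesis .
  qed
  then have "(\<Sum>h\<in>H k. scal (1 / (\<Prod>i = 1..n. fact (h i))) *
            foldr (\<lambda>i. polar i 0) (is h (rev [1..<Suc n])) (foldr (polar 0) (is h [1..<Suc n]) (hw_prod \<mu>))) =
     (\<Sum>h\<in>H k. \<Sum>V\<in>?D h. of_nat (\<Prod>i = 1..n. fact (col_card V i)) * hw_prod \<mu>)"
    by simp
  also have "\<dots> = (\<Sum>(h, V)\<in>Sigma (H k) ?D. of_nat (\<Prod>i = 1..n. fact (col_card V i)) * hw_prod \<mu>)"
    by (rule sum.Sigma) (use H finC in auto)
  also have "\<dots> = (\<Sum>V\<in>vstrips \<mu> k. of_nat (vstrip_fact V) * hw_prod \<mu>)"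
  \<comment> \<open>The inverse map recovers \<open>h\<close> from \<open>V\<close> by counting
    columns; \<open>restrict\<close> makes it extensional, as the compositions in \<open>H k\<close>
    are.\<close>
  proof (rule sum.reindex_bij_witness[of _ "\<lambda>V. (restrict (col_card V) {1..n}, V)" snd])
    fix a assume a: "a \<in> Sigma (H k) ?D"
    obtain h V where hV: "a = (h, V)" by force
    have "card V = k" using a hV card[of V] by (auto simp: H_def)
    then show "snd a \<in> vstrips \<mu> k" using a hV by (auto simp: vstrips_def)
    show "(restrict (col_card (snd a)) {1..n}, snd a) = a"
      using a hV by (auto simp: H_def PiE_iff extensional_def)
    \<comment> \<open>\<open>vstrip_fact\<close> multiplies over the columns that meet
      \<open>V\<close>; an empty column contributes the factorial of 0, which is 1, so the product
      may run over all of \<open>{1..n}\<close>.\<close>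
    have "vstrip_fact V = (\<Prod>i\<in>Suc ` snd ` V. fact (col_card V i))"
      unfolding vstrip_fact_def col_card_def by (simp add: prod.reindex)
    also have "\<dots> = (\<Prod>i = 1..n. fact (col_card V i))"
    proof (rule prod.mono_neutral_left)
      show "\<forall>i\<in>{1..n} - Suc ` snd ` V. fact (col_card V i) = (1 :: nat)"
      proof
        fix i assume "i \<in> {1..n} - Suc ` snd ` V"
        then have "{x \<in> V. Suc (snd x) = i} = {}" by blast
        then show "fact (col_card V i) = (1 :: nat)" unfolding col_card_def by (simp only: card.empty fact_0)
      qed
    qed (use a hV cols in auto)
    finally show "of_nat (vstrip_fact (snd a)) * hw_prod \<mu> =
        (case a of (h, V) \<Rightarrow> of_nat (\<Prod>i = 1..n. fact (col_card V i)) * hw_prod \<mu>)"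
      by (simp add: hV)
  next
    fix V assume "V \<in> vstrips \<mu> k"
    then have V: "V \<subseteq> ferrers \<mu>" "card V = k" "inj_on fst V" by (auto simp: vstrips_def)
    then show "(restrict (col_card V) {1..n}, V) \<in> Sigma (H k) ?D"
      using card[OF V(1)] by (auto simp: H_def)
  qed simp
  finally show ?thesis by (simp add: sum_distrib_right)
qed


section \<open>A representation of the superalgebra on tensors\<close>

lemma scal_0 [simp]: "scal 0 = 0"
  by (simp add: scal_def)

lemma scal_1 [simp]: "scal 1 = 1"
  by (simp add: scal_def)

lemma scal_add: "scal (a + b) = scal a + scal b"
  by (simp add: scal_def single_add)

lemma scal_mult: "scal a * scal b = scal (a * b)"
  by (simp add: scal_def mult_single)

lemma poly_mapping_add_induct [case_names single add]:
  assumes "\<And>m c. P (Poly_Mapping.single m c)" "\<And>p q. P p \<Longrightarrow> P q \<Longrightarrow> P (p + q)"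
  shows "P (p :: 'x \<Rightarrow>\<^sub>0 complex)"
proof (induction p rule: update_induct)
  case const show ?case using assms(1)[of undefined 0] by simp
next
  case (update f a b)
  have "Poly_Mapping.update a b f = f + Poly_Mapping.single a b"
    using update by (intro poly_mapping_eqI) (auto simp: lookup_update lookup_add lookup_single in_keys_iff when_def)
  then show ?case using assms update by simp
qed

lemma scal_commute: "p * scal c = scal c * p" for p :: "'k::monoid_add \<Rightarrow>\<^sub>0 complex"
  by (induction p rule: poly_mapping_add_induct)
     (simp_all add: scal_def mult_single distrib_left distrib_right mult.commute)

lemma scal_left_commute: "p * (scal c * q) = scal c * (p * q)" for p :: "'k::monoid_add \<Rightarrow>\<^sub>0 complex"
  unfolding mult.assoc[symmetric] scal_commute[of p] ..

lemma single_eq_scal: "Poly_Mapping.single w c = scal c * fword (mletters w)"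
  by (simp add: scal_def fword_def mult_single)

lemma free_alg_induct [case_names fword scal add]:
  assumes "\<And>w. P (fword w)" "\<And>c p. P p \<Longrightarrow> P (scal c * p)" "\<And>p q. P p \<Longrightarrow> P q \<Longrightarrow> P (p + q)"
  shows "P (p :: 'x mword \<Rightarrow>\<^sub>0 complex)"
  by (induction p rule: poly_mapping_add_induct) (simp_all add: single_eq_scal assms)

section \<open>Linear maps given on words\<close>

definition lin_ext :: "('x \<Rightarrow> ('k::monoid_add \<Rightarrow>\<^sub>0 complex)) \<Rightarrow> ('x \<Rightarrow>\<^sub>0 complex) \<Rightarrow> ('k \<Rightarrow>\<^sub>0 complex)" where
  "lin_ext F p = (\<Sum>w\<in>Poly_Mapping.keys p. scal (Poly_Mapping.lookup p w) * F w)"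

lemma lin_ext_superset:
  assumes "finite K" "Poly_Mapping.keys p \<subseteq> K"
  shows "lin_ext F p = (\<Sum>w\<in>K. scal (Poly_Mapping.lookup p w) * F w)"
  unfolding lin_ext_def by (rule sum.mono_neutral_left) (use assms in \<open>auto simp: in_keys_iff\<close>)

lemma lin_ext_0 [simp]: "lin_ext F 0 = 0"
  by (simp add: lin_ext_def)

lemma lin_ext_add: "lin_ext F (p + q) = lin_ext F p + lin_ext F q"
proof -
  let ?K = "Poly_Mapping.keys p \<union> Poly_Mapping.keys q"
  have "Poly_Mapping.keys (p + q) \<subseteq> ?K" by (rule Poly_Mapping.keys_add)
  then show ?thesis
    by (simp add: lin_ext_superset[of ?K] lookup_add sum.distrib[symmetric] distrib_right scal_add)
qed

lemma lin_ext_single: "lin_ext F (Poly_Mapping.single w c) = scal c * F w"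
  by (subst lin_ext_superset[of "{w}"]) simp_all

lemma lin_ext_fword: "lin_ext F (fword w) = F (MWord w)"
  by (simp add: fword_def lin_ext_single)

lemma lin_ext_scal: "lin_ext F (scal c * p) = scal c * lin_ext F p"
  for p :: "'x mword \<Rightarrow>\<^sub>0 complex"
proof (induction p rule: poly_mapping_add_induct)
  case (single w z)
  have "scal c * Poly_Mapping.single w z = Poly_Mapping.single w (c * z)"
    by (simp add: scal_def mult_single)
  then show ?case
    by (simp add: lin_ext_single scal_mult[symmetric] mult.assoc)
qed (simp add: lin_ext_add distrib_left)

lemma lin_ext_fun_add: "lin_ext (\<lambda>w. F w + G w) p = lin_ext F p + lin_ext G p"
  by (simp add: lin_ext_def distrib_left sum.distrib)

lemma lin_ext_fun_scal: "lin_ext (\<lambda>w. scal c * F w) p = scal c * lin_ext F p"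
  unfolding lin_ext_def sum_distrib_left by (intro sum.cong refl scal_left_commute)

lemma minus_eq_scal: "- p = scal (- 1) * p" for p :: "'k::monoid_add \<Rightarrow>\<^sub>0 complex"
  by (simp add: scal_def single_uminus)

text \<open>Letters \<open>(a, t)\<close> carry the parity \<open>|a| + 1\<close>, so that those with proper \<open>a\<close> are even and the
  tensors in them map to commutative polynomials.\<close>

definition super_sign :: "('a, 'b) symb \<Rightarrow> ('a, 'b) symb \<Rightarrow> ('a, 'b) symb \<Rightarrow> 'r::ring_1" where
  "super_sign a b c = (- 1) ^ ((par a + par b) * (par c + 1))"

text \<open>The super Leibniz rule on words: occurrences of \<open>b\<close> are replaced by
  \<open>a\<close> one at a time, with a sign for carrying the operator past the letters in
  front.\<close>

fun super_word :: "('a, 'b) symb \<Rightarrow> ('a, 'b) symb \<Rightarrow> (('a, 'b) symb \<times> nat) list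
    \<Rightarrow> ((('a, 'b) symb \<times> nat) mword \<Rightarrow>\<^sub>0 complex)" where
  "super_word a b [] = 0"
| "super_word a b ((c, t) # w) = (if b = c then fword ((a, t) # w) else 0)
     + super_sign a b c * (fword [(c, t)] * super_word a b w)"

definition super_pol :: "('a, 'b) symb \<Rightarrow> ('a, 'b) symb \<Rightarrow> ((('a, 'b) symb \<times> nat) mword \<Rightarrow>\<^sub>0 complex)
    \<Rightarrow> ((('a, 'b) symb \<times> nat) mword \<Rightarrow>\<^sub>0 complex)" where
  "super_pol a b = lin_ext (\<lambda>w. super_word a b (mletters w))"

lemma super_pol_0 [simp]: "super_pol a b 0 = 0"
  by (simp add: super_pol_def)

lemma super_pol_add: "super_pol a b (p + q) = super_pol a b p + super_pol a b q"
  by (simp add: super_pol_def lin_ext_add)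

lemma super_pol_scal: "super_pol a b (scal c * p) = scal c * super_pol a b p"
  by (simp add: super_pol_def lin_ext_scal)

lemma super_pol_minus: "super_pol a b (- p) = - super_pol a b p"
  unfolding minus_eq_scal super_pol_scal ..

lemma super_pol_sign: "super_pol a b ((- 1) ^ k * p) = (- 1) ^ k * super_pol a b p"
  by (simp add: minus_one_power_iff super_pol_minus)

lemma fword_Cons: "fword (x # w) = fword [x] * fword w"
  using fword_append[of "[x]" w] by simp

lemma super_sign_cases: "super_sign a b c = (1 :: 'r::ring_1) \<or> super_sign a b c = (- 1 :: 'r)"
  by (simp add: super_sign_def minus_one_power_iff)

lemma super_pol_super_sign: "super_pol a b (super_sign c d f * p) = super_sign c d f * super_pol a b p"
  by (simp add: super_sign_def super_pol_sign)

lemma super_pol_letter: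
  "super_pol a b (fword [(c, t)] * p) = (if b = c then fword [(a, t)] * p else 0)
     + super_sign a b c * (fword [(c, t)] * super_pol a b p)"
proof (induction p rule: free_alg_induct)
  case (fword w)
  then show ?case
    by (simp add: fword_Cons[symmetric] super_pol_def lin_ext_fword)
next
  case (scal z p)
  then show ?case
    using super_sign_cases[of a b c, where 'r = "(('a, 'b) symb \<times> nat) mword \<Rightarrow>\<^sub>0 complex"]
    by (auto simp: scal_left_commute super_pol_scal distrib_left right_diff_distrib)
next
  case (add p q)
  then show ?case
    by (simp add: super_pol_add distrib_left)
qed

lemma super_pol_Nil: "super_pol a b (fword []) = 0"
  by (simp add: super_pol_def lin_ext_fword)

lemma super_pol_twice:
  "super_pol a b (super_pol c d (fword [(f, t)] * p)) =
     (if d = f then (if b = c then fword [(a, t)] * p else 0)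
        + super_sign a b c * (fword [(c, t)] * super_pol a b p) else 0)
     + super_sign c d f * ((if b = f then fword [(a, t)] * super_pol c d p else 0)
        + super_sign a b f * (fword [(f, t)] * super_pol a b (super_pol c d p)))"
  by (simp add: super_pol_letter super_pol_add super_pol_super_sign)

text \<open>The step for a leading letter in the proof of the bracket relation below, with signs and terms
  abstracted.\<close>

lemma super_sign_ring_identity:
  fixes s s1 s2 :: "'r::ring_1"
  assumes "s = 1 \<or> s = - 1" "s1 = 1 \<or> s1 = - 1" "s2 = 1 \<or> s2 = - 1"
    and "D \<Longrightarrow> u = s * s1" "B \<Longrightarrow> v = s * s2" "C \<Longrightarrow> y = s1 * s2" "A \<Longrightarrow> z = s1 * s2"
  shows "(if D then (if C then x1 else 0) + u * x2 else 0)
      + s2 * ((if B then x3 else 0) + s1 * (x * (s * e4 + ((if C then e5 else 0) - s * (if A then e6 else 0))))) =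
    s * ((if B then (if A then x7 else 0) + v * x3 else 0) + s1 * ((if D then x2 else 0) + s2 * (x * e4)))
      + ((if C then (if D then x1 else 0) + y * (x * e5) else 0)
         - s * (if A then (if B then x7 else 0) + z * (x * e6) else 0))"
  using assms
  by (elim disjE; cases D; cases B; cases C; cases A) (simp_all add: distrib_left right_diff_distrib)

text \<open>The supercommutator of two superderivations is again a superderivation, so it is fixed
  by its values on letters, where it is that of matrix units. In the induction over the word, the
  terms in which the two operators hit different letters cancel by the signs.\<close>

lemma super_pol_bracket:
  "super_pol a b (super_pol c d p) =
     (- 1) ^ ((par a + par b) * (par c + par d)) * super_pol c d (super_pol a b p)
     + ((if b = c then super_pol a d p else 0)
        - (- 1) ^ ((par a + par b) * (par c + par d)) * (if a = d then super_pol c b p else 0))"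
proof (induction p rule: free_alg_induct)
  case (fword w)
  define s :: "(('a, 'b) symb \<times> nat) mword \<Rightarrow>\<^sub>0 complex"
    where "s = (- 1) ^ ((par a + par b) * (par c + par d))"
  let ?\<sigma> = "super_sign :: _ \<Rightarrow> _ \<Rightarrow> _ \<Rightarrow> (('a, 'b) symb \<times> nat) mword \<Rightarrow>\<^sub>0 complex"
  have s: "s = 1 \<or> s = - 1"
    by (simp add: s_def minus_one_power_iff)
  show ?case
    unfolding s_def[symmetric]
  proof (induction w)
    case Nil
    then show ?case by (simp add: super_pol_Nil)
  next
    case (Cons x w)
    obtain f t where x: "x = (f, t)" by force
    \<comment> \<open>The operator for \<open>(c, d)\<close> turns the letter \<open>d\<close> into
      \<open>c\<close> and so changes its parity by its own; hence the sign for passing the operator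
      for \<open>(a, b)\<close> over that letter changes by \<open>s\<close>. The last two
      identities express that parities add when matrix units are multiplied.\<close>
    have \<sigma>1: "?\<sigma> a b c = s * ?\<sigma> a b f" if "d = f"
      using that by (cases a; cases b; cases c; cases f) (simp_all add: super_sign_def s_def)
    have \<sigma>2: "?\<sigma> c d a = s * ?\<sigma> c d f" if "b = f"
      using that by (cases a; cases c; cases d; cases f) (simp_all add: super_sign_def s_def)
    have \<sigma>3: "?\<sigma> a d f = ?\<sigma> a b f * ?\<sigma> c d f" if "b = c"
      using that by (cases a; cases c; cases d; cases f) (simp_all add: super_sign_def s_def)
    have \<sigma>4: "?\<sigma> c b f = ?\<sigma> a b f * ?\<sigma> c d f" if "a = d"
      using that by (cases b; cases c; cases d; cases f) (simp_all add: super_sign_def s_def)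
    have \<sigma>: "?\<sigma> a b f = 1 \<or> ?\<sigma> a b f = - 1" "?\<sigma> c d f = 1 \<or> ?\<sigma> c d f = - 1"
      by (rule super_sign_cases)+
    show ?case
      unfolding x fword_Cons[of "(f, t)" w] super_pol_twice
      unfolding super_pol_letter Cons.IH eq_commute[of d a]
      by (rule super_sign_ring_identity) (fact s \<sigma> | erule \<sigma>1 \<sigma>2 \<sigma>3 \<sigma>4)+
  qed
next
  case (scal z p)
  have sgn: "scal z * ((- 1) ^ k * q) = (- 1) ^ k * (scal z * q)"
    for k and q :: "(('a, 'b) symb \<times> nat) mword \<Rightarrow>\<^sub>0 complex"
    by (simp add: minus_one_power_iff)
  show ?case
    unfolding super_pol_scal scal by (auto simp: distrib_left right_diff_distrib sgn)
next
  case (add p q)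
  show ?case unfolding super_pol_add add by (simp add: distrib_left right_diff_distrib)
qed

section \<open>The representation of the tensor algebra\<close>

definition rep :: "('a, 'b) talg \<Rightarrow> ((('a, 'b) symb \<times> nat) mword \<Rightarrow>\<^sub>0 complex)
    \<Rightarrow> ((('a, 'b) symb \<times> nat) mword \<Rightarrow>\<^sub>0 complex)" where
  "rep f p = lin_ext (\<lambda>w. foldr (\<lambda>(a, b). super_pol a b) (mletters w) p) f"

lemma rep_fword: "rep (fword w) p = foldr (\<lambda>(a, b). super_pol a b) w p"
  by (simp add: rep_def lin_ext_fword)

lemma rep_0 [simp]: "rep 0 p = 0"
  by (simp add: rep_def)

lemma rep_add: "rep (f + g) p = rep f p + rep g p"
  by (simp add: rep_def lin_ext_add)

lemma rep_scal: "rep (scal c * f) p = scal c * rep f p"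
  by (simp add: rep_def lin_ext_scal)

lemma rep_minus: "rep (- f) p = - rep f p"
  unfolding minus_eq_scal rep_scal ..

lemma rep_diff: "rep (f - g) p = rep f p - rep g p"
  using rep_add[of f "- g" p] by (simp add: rep_minus)

lemma rep_sum: "rep (\<Sum>x\<in>A. f x) p = (\<Sum>x\<in>A. rep (f x) p)"
  by (induction A rule: infinite_finite_induct) (simp_all add: rep_add)

lemma foldr_super_pol_add:
  "foldr (\<lambda>(a, b). super_pol a b) w (p + q) =
     foldr (\<lambda>(a, b). super_pol a b) w p + foldr (\<lambda>(a, b). super_pol a b) w q"
  by (induction w) (auto simp: super_pol_add)

lemma foldr_super_pol_scal:
  "foldr (\<lambda>(a, b). super_pol a b) w (scal c * p) = scal c * foldr (\<lambda>(a, b). super_pol a b) w p"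
  by (induction w) (auto simp: super_pol_scal)

lemma rep_add_right: "rep f (p + q) = rep f p + rep f q"
  by (simp add: rep_def foldr_super_pol_add lin_ext_fun_add)

lemma rep_scal_right: "rep f (scal c * p) = scal c * rep f p"
  by (simp add: rep_def foldr_super_pol_scal lin_ext_fun_scal)

lemma rep_0_right [simp]: "rep f 0 = 0"
  using rep_scal_right[of f 0 0] by simp

lemma rep_mult: "rep (f * g) p = rep f (rep g p)"
proof (induction f rule: free_alg_induct)
  case (fword u)
  show ?case
  proof (induction g rule: free_alg_induct)
    case (fword v)
    then show ?case by (simp add: fword_append[symmetric] rep_fword)
  next
    case (scal c g)
    then show ?case by (simp add: scal_left_commute rep_scal rep_scal_right)
  next
    case (add g h)
    then show ?case by (simp add: distrib_left rep_add rep_add_right)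
  qed
next
  case (scal c f)
  then show ?case by (simp add: mult.assoc rep_scal)
next
  case (add f g)
  then show ?case by (simp add: distrib_right rep_add)
qed

lemma rep_super_rel: "rep (super_rel a b c d) p = 0"
proof -
  have sgn: "rep ((- 1) ^ k * f) p = (- 1) ^ k * rep f p" for k and f :: "('a, 'b) talg"
    by (simp add: minus_one_power_iff rep_minus)
  show ?thesis
    using super_pol_bracket[of a b c d p]
    by (auto simp: super_rel_def Let_def rep_diff sgn rep_fword)
qed


section \<open>The enveloping algebra acts\<close>

lemma tens_simps [simp]:
  "f \<otimes>\<^bsub>tens S\<^esub> g = f * g" "f \<oplus>\<^bsub>tens S\<^esub> g = f + g" "\<one>\<^bsub>tens S\<^esub> = 1" "\<zero>\<^bsub>tens S\<^esub> = 0"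
  by (simp_all add: tens_def free_alg_def)

lemma carrier_tens: "carrier (tens S) = {f. \<forall>w\<in>Poly_Mapping.keys f. set (mletters w) \<subseteq> S \<times> S}"
  by (simp add: tens_def free_alg_def)

lemma ring_tens: "ring (tens S)"
  unfolding tens_def by (rule ring_free_alg)

interpretation tens: ring "tens S" for S
  by (rule ring_tens)

lemma tens_minus_closed: "f \<in> carrier (tens S) \<Longrightarrow> - f \<in> carrier (tens S)"
  by (simp add: carrier_tens)

lemma tens_uminus [simp]: "f \<in> carrier (tens S) \<Longrightarrow> \<ominus>\<^bsub>tens S\<^esub> f = - f"
  by (intro tens.minus_equality) (auto intro: tens_minus_closed)

lemma tens_minus [simp]:
  "f \<in> carrier (tens S) \<Longrightarrow> g \<in> carrier (tens S) \<Longrightarrow> f \<ominus>\<^bsub>tens S\<^esub> g = f - g"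
  by (simp add: a_minus_def)

lemma tens_add_closed: "f \<in> carrier (tens S) \<Longrightarrow> g \<in> carrier (tens S) \<Longrightarrow> f + g \<in> carrier (tens S)"
  using tens.add.m_closed[of f S g] by simp

lemma tens_diff_closed: "f \<in> carrier (tens S) \<Longrightarrow> g \<in> carrier (tens S) \<Longrightarrow> f - g \<in> carrier (tens S)"
  using tens_add_closed[of f S "- g"] tens_minus_closed[of g S] by simp

lemma tens_mult_closed: "f \<in> carrier (tens S) \<Longrightarrow> g \<in> carrier (tens S) \<Longrightarrow> f * g \<in> carrier (tens S)"
  using tens.m_closed[of f S g] by simp

lemma tens_0_closed: "0 \<in> carrier (tens S)"
  using tens.zero_closed[of S] by simp

lemma tens_sum_closed: "(\<And>x. x \<in> A \<Longrightarrow> f x \<in> carrier (tens S)) \<Longrightarrow> (\<Sum>x\<in>A. f x) \<in> carrier (tens S)"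
  by (induction A rule: infinite_finite_induct) (auto simp: tens_0_closed intro: tens_add_closed)

lemma tens_scal_closed: "scal c \<in> carrier (tens S)"
  by (simp add: carrier_tens scal_def zero_mword_def)

lemma tens_fword_closed: "set w \<subseteq> S \<times> S \<Longrightarrow> fword w \<in> carrier (tens S)"
  by (simp add: carrier_tens fword_def)

lemma tens_mono: "f \<in> carrier (tens S) \<Longrightarrow> S \<subseteq> T \<Longrightarrow> f \<in> carrier (tens T)"
  by (fastforce simp: carrier_tens)

lemmas tens_closed = tens_add_closed tens_diff_closed tens_mult_closed tens_0_closed
  tens_sum_closed tens_scal_closed tens_fword_closed tens_minus_closed

lemma super_rel_closed:
  assumes "a \<in> S" "b \<in> S" "c \<in> S" "d \<in> S"
  shows "super_rel a b c d \<in> carrier (tens S)"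
proof -
  have sgn: "(- 1) ^ k * f \<in> carrier (tens S)" if "f \<in> carrier (tens S)" for k and f :: "('a, 'b) talg"
    using that by (simp add: minus_one_power_iff tens_minus_closed)
  show ?thesis
    unfolding super_rel_def Let_def using assms
    by (intro tens_diff_closed) (auto intro!: tens_fword_closed sgn simp: tens_0_closed)
qed

lemma ideal_env_ideal: "ideal (env_ideal S) (tens S)"
  unfolding env_ideal_def by (rule tens.genideal_ideal) (auto intro: super_rel_closed)

lemma super_rel_in_env_ideal:
  "a \<in> S \<Longrightarrow> b \<in> S \<Longrightarrow> c \<in> S \<Longrightarrow> d \<in> S \<Longrightarrow> super_rel a b c d \<in> env_ideal S"
  unfolding env_ideal_def by (rule subsetD[OF tens.genideal_self]) (auto intro: super_rel_closed)

text \<open>By \<open>rep_mult\<close>, the tensors that act as zero form a two-sided ideal, and it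
  contains the defining relations.\<close>

lemma rep_env_ideal: assumes "f \<in> env_ideal S" shows "rep f p = 0"
proof -
  let ?K = "{f \<in> carrier (tens S). \<forall>p. rep f p = 0}"
  have "ideal ?K (tens S)"
  proof (rule idealI)
    show "subgroup ?K (add_monoid (tens S))"
    proof (rule tens.add.subgroupI)
      show "?K \<noteq> {}" using tens_0_closed by auto
    qed (auto simp: tens_closed rep_add rep_minus)
  qed (auto simp: ring_tens tens_closed rep_mult)
  then have "env_ideal S \<subseteq> ?K"
    unfolding env_ideal_def by (rule tens.genideal_minimal) (auto simp: super_rel_closed rep_super_rel)
  then show ?thesis using assms by auto
qed

lemma env_class_hom: "ring_hom_ring (tens S) (env S) (env_class S)"
  using ideal.rcos_ring_hom_ring[OF ideal_env_ideal[of S]] by (simp add: env_def env_class_def[abs_def])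

interpretation env: ring_hom_ring "tens S" "env S" "env_class S" for S
  by (rule env_class_hom)

lemma env_class_add: "f \<in> carrier (tens S) \<Longrightarrow> g \<in> carrier (tens S) \<Longrightarrow>
    env_class S (f + g) = env_class S f \<oplus>\<^bsub>env S\<^esub> env_class S g"
  using env.hom_add[of f S g] by simp

lemma env_class_mult: "f \<in> carrier (tens S) \<Longrightarrow> g \<in> carrier (tens S) \<Longrightarrow>
    env_class S (f * g) = env_class S f \<otimes>\<^bsub>env S\<^esub> env_class S g"
  using env.hom_mult[of f S g] by simp

lemma env_class_uminus: "f \<in> carrier (tens S) \<Longrightarrow> env_class S (- f) = \<ominus>\<^bsub>env S\<^esub> env_class S f"
  using env.hom_a_inv[of f S] by simp

lemma env_class_diff: "f \<in> carrier (tens S) \<Longrightarrow> g \<in> carrier (tens S) \<Longrightarrow>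
    env_class S (f - g) = env_class S f \<ominus>\<^bsub>env S\<^esub> env_class S g"
  using env_class_add[of f S "- g"] by (simp add: tens_minus_closed env_class_uminus a_minus_def)

lemma env_class_1: "env_class S 1 = \<one>\<^bsub>env S\<^esub>"
  using env.hom_one[of S] by simp

lemma env_class_0: "env_class S 0 = \<zero>\<^bsub>env S\<^esub>"
  using env.hom_zero[of S] by simp

lemma carrier_env: "carrier (env S) = env_class S ` carrier (tens S)"
  by (auto simp: env_def env_class_def FactRing_def A_RCOSETS_def')

lemma env_cases:
  assumes "x \<in> carrier (env S)"
  obtains f where "f \<in> carrier (tens S)" "x = env_class S f"
proof -
  have "x \<in> env_class S ` carrier (tens S)"
    using assms by (simp only: carrier_env)
  then show ?thesis by (rule imageE) (rule that)
qed

lemma env_class_eq_iff: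
  assumes "f \<in> carrier (tens S)" "g \<in> carrier (tens S)"
  shows "env_class S f = env_class S g \<longleftrightarrow> f - g \<in> env_ideal S"
  using tens.quotient_eq_iff_same_a_r_cos[OF ideal_env_ideal assms] assms
  by (simp add: env_class_def)

lemma in_env_class_iff:
  assumes "g \<in> carrier (tens S)"
  shows "f \<in> env_class S g \<longleftrightarrow> f - g \<in> env_ideal S"
  by (auto simp: env_class_def a_r_coset_def' intro: rev_bexI)

text \<open>Lets classes act through any representative, without a separate definition of the action
  on \<open>env S\<close>.\<close>

lemma env_class_eq_rep:
  "f \<in> carrier (tens S) \<Longrightarrow> g \<in> carrier (tens S) \<Longrightarrow> env_class S f = env_class S g \<Longrightarrow> rep f p = rep g p"
  using rep_env_ideal[of "f - g" S p] by (simp add: env_class_eq_iff rep_diff)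

lemma env_class_finsum:
  assumes "finite A" "\<And>x. x \<in> A \<Longrightarrow> f x \<in> carrier (tens S)"
  shows "(\<Oplus>\<^bsub>env S\<^esub>x\<in>A. env_class S (f x)) = env_class S (\<Sum>x\<in>A. f x)"
  using assms
proof (induction A)
  case (insert x A)
  then have "env_class S \<circ> f \<in> A \<rightarrow> carrier (env S)" by (auto simp: carrier_env)
  then show ?case
    using insert by (subst env.S.finsum_insert) (auto simp: carrier_env env_class_add tens_closed)
qed (simp add: env_class_0)

lemma additive_subgroup_envI:
  assumes "J \<subseteq> carrier (env S)" "J \<noteq> {}" "\<And>y. y \<in> J \<Longrightarrow> \<ominus>\<^bsub>env S\<^esub> y \<in> J"
    and "\<And>y z. y \<in> J \<Longrightarrow> z \<in> J \<Longrightarrow> y \<oplus>\<^bsub>env S\<^esub> z \<in> J"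
  shows "additive_subgroup J (env S)"
proof -
  have "subgroup J (add_monoid (env S))"
    using env.S.add.subgroupI[OF assms(1,2)] assms(3,4) by blast
  then show ?thesis by (rule additive_subgroup.intro)
qed


section \<open>Irregular products annihilate proper tensors\<close>

text \<open>These tensors play the part of vacuum vectors: no virtual symbol is present before a
  word acts.\<close>

definition proper_tensors :: "((('a, 'b) symb \<times> nat) mword \<Rightarrow>\<^sub>0 complex) set" where
  "proper_tensors = {p. \<forall>w\<in>Poly_Mapping.keys p. fst ` set (mletters w) \<subseteq> range Prop}"

lemma super_word_absent: "b \<notin> fst ` set w \<Longrightarrow> super_word a b w = 0"
  by (induction a b w rule: super_word.induct) auto

lemma keys_scal_mult_subset: "Poly_Mapping.keys (scal c * p) \<subseteq> Poly_Mapping.keys p"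
  for p :: "'k::monoid_add \<Rightarrow>\<^sub>0 complex"
  using keys_mult[of "scal c" p] by (auto simp: scal_def split: if_splits)

lemma keys_lin_ext: "Poly_Mapping.keys (lin_ext F p) \<subseteq> (\<Union>w\<in>Poly_Mapping.keys p. Poly_Mapping.keys (F w))"
proof -
  have "Poly_Mapping.keys (\<Sum>w\<in>A. scal (c w) * F w) \<subseteq> (\<Union>w\<in>A. Poly_Mapping.keys (F w))" for A c
  proof (induction A rule: infinite_finite_induct)
    case (insert x A)
    have "Poly_Mapping.keys (\<Sum>w\<in>insert x A. scal (c w) * F w) \<subseteq>
      Poly_Mapping.keys (scal (c x) * F x) \<union> Poly_Mapping.keys (\<Sum>w\<in>A. scal (c w) * F w)"
      using insert.hyps by (simp add: Poly_Mapping.keys_add)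
    then show ?case using insert.IH keys_scal_mult_subset[of "c x" "F x"] by auto
  qed auto
  then show ?thesis unfolding lin_ext_def .
qed

text \<open>Every term trades one \<open>b\<close> for one \<open>a\<close>. The balance is written
  with sums on both sides, which avoids truncated subtraction.\<close>

lemma count_super_word:
  assumes "v \<in> Poly_Mapping.keys (super_word a b w)"
  shows "count_list (map fst (mletters v)) \<gamma> + of_bool (b = \<gamma>) =
         count_list (map fst w) \<gamma> + of_bool (a = \<gamma>)"
  using assms
proof (induction a b w arbitrary: v rule: super_word.induct)
  case (2 a b c t w)
  let ?p = "super_sign a b c * (fword [(c, t)] * super_word a b w)"
  have "Poly_Mapping.keys ?p = Poly_Mapping.keys (fword [(c, t)] * super_word a b w)"
    using super_sign_cases[of a b c, where 'r = "(('a, 'b) symb \<times> nat) mword \<Rightarrow>\<^sub>0 complex"] by auto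
  also have "\<dots> \<subseteq> {MWord [(c, t)] + u | u. u \<in> Poly_Mapping.keys (super_word a b w)}"
    using keys_mult[of "fword [(c, t)]" "super_word a b w"] by (auto simp: fword_def)
  finally have "v = MWord ((a, t) # w) \<and> b = c \<or>
      (\<exists>u \<in> Poly_Mapping.keys (super_word a b w). v = MWord [(c, t)] + u)"
    using 2(2) Poly_Mapping.keys_add[of "if b = c then fword ((a, t) # w) else 0" ?p]
    by (auto simp: fword_def split: if_splits)
  then show ?case
    using 2(1) by (fastforce simp: plus_mword_def)
qed simp

text \<open>No virtual symbol is present at the start, so a surviving term contains as many \<gamma>
  as were created minus those annihilated.\<close>

lemma count_foldr_super_pol:
  assumes "p \<in> proper_tensors" "\<gamma> \<notin> range Prop"
    and "v \<in> Poly_Mapping.keys (foldr (\<lambda>(a, b). super_pol a b) u p)"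
  shows "count_list (map fst (mletters v)) \<gamma> + count_list (map snd u) \<gamma> = count_list (map fst u) \<gamma>"
  using assms(3)
proof (induction u arbitrary: v)
  case Nil
  then have "fst ` set (mletters v) \<subseteq> range Prop"
    using assms(1) by (auto simp: proper_tensors_def)
  then have "\<gamma> \<notin> set (map fst (mletters v))" using assms(2) by auto
  then show ?case by (simp add: count_list_0_iff del: set_map)
next
  case (Cons x u)
  obtain a b where x: "x = (a, b)" by force
  have "v \<in> Poly_Mapping.keys (lin_ext (\<lambda>w. super_word a b (mletters w)) (foldr (\<lambda>(a, b). super_pol a b) u p))"
    using Cons.prems by (simp add: x super_pol_def)
  from subsetD[OF keys_lin_ext this]
  obtain w where w: "w \<in> Poly_Mapping.keys (foldr (\<lambda>(a, b). super_pol a b) u p)"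
      "v \<in> Poly_Mapping.keys (super_word a b (mletters w))"
    by blast
  show ?case
    using Cons.IH[OF w(1)] count_super_word[OF w(2), of \<gamma>] by (auto simp: x of_bool_def split: if_splits)
qed

text \<open>In every term that survives the letters to the right of the offending one, all copies of
  \<gamma> created so far have been annihilated again, and the offending letter would have to remove
  one more.\<close>

lemma irregular_annihilates:
  assumes "irregular A0 A1 w" "p \<in> proper_tensors"
  shows "rep (fword w) p = 0"
proof -
  obtain i \<gamma> where i: "i < length w" and \<gamma>: "\<gamma> \<in> virtuals A0 A1" and
    gt: "count_list (map snd (take (Suc i) (rev w))) \<gamma> > count_list (map fst (take i (rev w))) \<gamma>"
    using assms(1) by (auto simp: irregular_def)
  \<comment> \<open>Words act from the right, so \<open>u\<close> consists of the \<open>i\<close>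
    letters that act before the offending one.\<close>
  define u where "u = rev (take i (rev w))"
  obtain a b where ab: "rev w ! i = (a, b)" by force
  have "rev w = take i (rev w) @ (a, b) # drop (Suc i) (rev w)"
    using i ab id_take_nth_drop[of i "rev w"] by simp
  then have "rev (rev w) = rev (take i (rev w) @ (a, b) # drop (Suc i) (rev w))"
    by (rule arg_cong)
  then have "w = rev (drop (Suc i) (rev w)) @ (a, b) # u"
    by (simp only: rev_rev_ident rev_append rev.simps append_assoc append.simps u_def)
  then obtain u' where w: "w = u' @ (a, b) # u" by blast
  have tk: "take (Suc i) (rev w) = take i (rev w) @ [(a, b)]"
    using i ab by (simp add: take_Suc_conv_app_nth)
  have cr: "count_list (rev xs) x = count_list xs x" for xs :: "('a, 'b) symb list" and x
    by (induction xs) auto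
  have \<gamma>': "\<gamma> \<notin> range Prop" using \<gamma> by (auto simp: virtuals_def)
  let ?q = "foldr (\<lambda>(a, b). super_pol a b) u p"
  have "super_word a b (mletters v) = 0" if v: "v \<in> Poly_Mapping.keys ?q" for v
  proof -
    have "count_list (map fst (mletters v)) \<gamma> + count_list (map snd u) \<gamma> = count_list (map fst u) \<gamma>"
      by (rule count_foldr_super_pol[OF assms(2) \<gamma>' v])
    moreover have "count_list (map snd u) \<gamma> + of_bool (b = \<gamma>) > count_list (map fst u) \<gamma>"
      using gt unfolding tk u_def by (simp add: rev_map[symmetric] cr split: if_splits)
    ultimately have "b = \<gamma>" "count_list (map fst (mletters v)) \<gamma> = 0"
      by (auto simp: of_bool_def split: if_splits)
    then show ?thesis
      by (intro super_word_absent) (auto simp: count_list_0_iff)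
  qed
  then have "super_pol a b ?q = 0"
    unfolding super_pol_def lin_ext_def by (intro sum.neutral) auto
  moreover have "foldr (\<lambda>(a, b). super_pol a b) z 0 = 0" for z :: "(('a, 'b) symb \<times> ('a, 'b) symb) list"
    by (induction z) auto
  ultimately show ?thesis
    unfolding w by (simp add: rep_fword)
qed

text \<open>The classes with a representative that kills all proper tensors form a left ideal:
  whatever acts afterwards acts on 0. It contains the irregular products, hence all of
  \<open>Irr\<close>.\<close>

lemma Irr_annihilates:
  assumes "x \<in> Irr A0 A1 n"
  shows "\<exists>f \<in> carrier (tens (symbs A0 A1 n)). x = env_class (symbs A0 A1 n) f \<and>
           (\<forall>p \<in> proper_tensors. rep f p = 0)"
proof -
  let ?S = "symbs A0 A1 n"
  define N where "N = {f \<in> carrier (tens ?S). \<forall>p \<in> proper_tensors. rep f p = 0}"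
  define J where "J = env_class ?S ` N"
  have N_closed: "f \<in> carrier (tens ?S)" if "f \<in> N" for f
    using that by (simp add: N_def)
  have N_uminus: "- f \<in> N" if "f \<in> N" for f
    using that by (simp add: N_def tens_minus_closed rep_minus)
  have N_add: "f + g \<in> N" if "f \<in> N" "g \<in> N" for f g
    using that by (simp add: N_def tens_add_closed rep_add)
  have Jc: "J \<subseteq> carrier (env ?S)" unfolding carrier_env J_def using N_closed by blast
  have "0 \<in> N" by (simp add: N_def tens_0_closed)
  then have Jne: "J \<noteq> {}" unfolding J_def by blast
  have Jm: "\<ominus>\<^bsub>env ?S\<^esub> y \<in> J" if y: "y \<in> J" for y
  proof -
    obtain f where f: "f \<in> N" "y = env_class ?S f" using y unfolding J_def by blast
    have "\<ominus>\<^bsub>env ?S\<^esub> y = env_class ?S (- f)"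
      unfolding f(2) by (rule env_class_uminus[symmetric, OF N_closed[OF f(1)]])
    then show ?thesis unfolding J_def using N_uminus[OF f(1)] by (rule image_eqI)
  qed
  have Jp: "y \<oplus>\<^bsub>env ?S\<^esub> z \<in> J" if y: "y \<in> J" and z: "z \<in> J" for y z
  proof -
    obtain f where f: "f \<in> N" "y = env_class ?S f" using y unfolding J_def by blast
    obtain g where g: "g \<in> N" "z = env_class ?S g" using z unfolding J_def by blast
    have "y \<oplus>\<^bsub>env ?S\<^esub> z = env_class ?S (f + g)"
      unfolding f(2) g(2) by (rule env_class_add[symmetric, OF N_closed[OF f(1)] N_closed[OF g(1)]])
    then show ?thesis unfolding J_def using N_add[OF f(1) g(1)] by (rule image_eqI)
  qed
  have J1: "additive_subgroup J (env ?S)"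
    using Jc Jne Jm Jp by (rule additive_subgroup_envI)
  have J2: "x \<otimes>\<^bsub>env ?S\<^esub> y \<in> J" if x: "x \<in> carrier (env ?S)" and y: "y \<in> J" for x y
  proof -
    obtain f where f: "f \<in> carrier (tens ?S)" "x = env_class ?S f"
      using x by (rule env_cases)
    obtain g where g: "g \<in> N" "y = env_class ?S g"
      using y unfolding J_def by blast
    have "x \<otimes>\<^bsub>env ?S\<^esub> y = env_class ?S (f * g)"
      unfolding f(2) g(2) by (rule env_class_mult[symmetric, OF f(1) N_closed[OF g(1)]])
    moreover have "f * g \<in> N"
      using f(1) g(1) by (simp add: N_def tens_mult_closed rep_mult)
    ultimately show ?thesis unfolding J_def by (rule image_eqI)
  qed
  have J3: "{env_class ?S (fword w) | w. set w \<subseteq> ?S \<times> ?S \<and> irregular A0 A1 w} \<subseteq> J"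
  proof clarify
    fix w assume w: "set w \<subseteq> ?S \<times> ?S" "irregular A0 A1 w"
    have "fword w \<in> N"
      unfolding N_def using tens_fword_closed[OF w(1)] irregular_annihilates[OF w(2)] by simp
    then show "env_class ?S (fword w) \<in> J" unfolding J_def by (rule imageI)
  qed
  have "Irr A0 A1 n \<subseteq> J"
    unfolding Irr_def gen_left_ideal_def Let_def by (intro Inter_lower CollectI conjI ballI J1 J2 J3)
  then obtain f where "f \<in> N" "x = env_class ?S f" using assms unfolding J_def by blast
  then show ?thesis unfolding N_def by auto
qed


section \<open>Devirtualization of balanced words\<close>

lemma propers_subset_symbs: "propers n \<subseteq> symbs A0 A1 n"
  by (simp add: symbs_def)

lemma Virt1_in_symbs: "\<beta> \<in> A1 \<Longrightarrow> Virt1 \<beta> \<in> symbs A0 A1 n"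
  by (simp add: symbs_def virtuals_def)

text \<open>Elements of \<open>env_gl\<close> are classes in the large algebra; a representative in
  the proper letters is what \<open>gl_act\<close> asks for.\<close>

lemma env_gl_cases:
  assumes "u \<in> env_gl A0 A1 n"
  obtains f where "f \<in> carrier (tens (propers n))" "u = env_class (symbs A0 A1 n) f"
proof -
  let ?S = "symbs A0 A1 n"
  have sub: "f \<in> carrier (tens ?S)" if "f \<in> carrier (tens (propers n))" for f :: "('a, 'b) talg"
    using that propers_subset_symbs by (rule tens_mono)
  have "\<exists>f. f \<in> carrier (tens (propers n)) \<and> u = env_class ?S f"
    using assms unfolding env_gl_def Let_def
  proof (induction u rule: generate_ring.induct)
    case one
    have "1 \<in> carrier (tens (propers n) :: ('a, 'b) talg ring)"
      using tens.one_closed[of "propers n"] by simp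
    then show ?case using env_class_1[of ?S] by metis
  next
    case (incl h)
    then consider c where "h = env_class ?S (scal c)"
      | i j where "h = env_class ?S (fword [(Prop i, Prop j)])" "i \<in> {1..n}" "j \<in> {1..n}" by auto
    then show ?case
    proof cases
      case 1
      then show ?thesis using tens_scal_closed by blast
    next
      case 2
      have "fword [(Prop i, Prop j)] \<in> carrier (tens (propers n))"
        using 2 by (intro tens_fword_closed) (auto simp: propers_def)
      then show ?thesis using 2(1) by blast
    qed
  next
    case (a_inv h)
    then obtain f where f: "f \<in> carrier (tens (propers n))" "h = env_class ?S f" by blast
    have "\<ominus>\<^bsub>env ?S\<^esub> h = env_class ?S (- f)"
      unfolding f(2) by (rule env_class_uminus[symmetric, OF sub[OF f(1)]])
    then show ?case using tens_minus_closed[OF f(1)] by blast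
  next
    case (eng_add h h')
    then obtain f g where fg: "f \<in> carrier (tens (propers n))" "h = env_class ?S f"
      "g \<in> carrier (tens (propers n))" "h' = env_class ?S g" by blast
    have "h \<oplus>\<^bsub>env ?S\<^esub> h' = env_class ?S (f + g)"
      unfolding fg(2,4) by (rule env_class_add[symmetric, OF sub[OF fg(1)] sub[OF fg(3)]])
    then show ?case using tens_add_closed[OF fg(1,3)] by blast
  next
    case (eng_mult h h')
    then obtain f g where fg: "f \<in> carrier (tens (propers n))" "h = env_class ?S f"
      "g \<in> carrier (tens (propers n))" "h' = env_class ?S g" by blast
    have "h \<otimes>\<^bsub>env ?S\<^esub> h' = env_class ?S (f * g)"
      unfolding fg(2,4) by (rule env_class_mult[symmetric, OF sub[OF fg(1)] sub[OF fg(3)]])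
    then show ?case using tens_mult_closed[OF fg(1,3)] by blast
  qed
  then show ?thesis using that by blast
qed

lemma env_gl_word:
  assumes "set w \<subseteq> propers n \<times> propers n"
  shows "env_class (symbs A0 A1 n) (fword w) \<in> env_gl A0 A1 n"
  using assms
proof (induction w)
  case Nil
  then show ?case
    by (simp add: fword_Nil env_class_1 env_gl_def Let_def generate_ring.one)
next
  case (Cons x w)
  let ?S = "symbs A0 A1 n"
  have closed: "fword [x] \<in> carrier (tens ?S)" "fword w \<in> carrier (tens ?S)"
    using Cons.prems propers_subset_symbs[of n A0 A1] by (intro tens_fword_closed; fastforce)+
  obtain i j where x: "x = (Prop i, Prop j)" "i \<in> {1..n}" "j \<in> {1..n}"
    using Cons.prems by (auto simp: propers_def)
  have "env_class ?S (fword [x]) \<in> env_gl A0 A1 n"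
    unfolding env_gl_def Let_def x(1)
    by (intro generate_ring.incl UnI2 CollectI exI[of _ i] exI[of _ j] conjI refl x)
  moreover have "env_class ?S (fword w) \<in> env_gl A0 A1 n"
    using Cons by simp
  ultimately show ?case
    unfolding fword_Cons[of x w] env_class_mult[OF closed]
    unfolding env_gl_def Let_def by (rule generate_ring.eng_mult)
qed

lemma additive_subgroup_Irr: "additive_subgroup (Irr A0 A1 n) (env (symbs A0 A1 n))"
proof -
  let ?S = "symbs A0 A1 n"
  let ?X = "{env_class ?S (fword w) | w. set w \<subseteq> ?S \<times> ?S \<and> irregular A0 A1 w}"
  let ?\<J> = "{I. additive_subgroup I (env ?S) \<and>
    (\<forall>x\<in>carrier (env ?S). \<forall>y\<in>I. x \<otimes>\<^bsub>env ?S\<^esub> y \<in> I) \<and> ?X \<subseteq> I}"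
  have Irr: "Irr A0 A1 n = \<Inter> ?\<J>"
    by (simp add: Irr_def gen_left_ideal_def Let_def)
  have "carrier (env ?S) \<in> ?\<J>"
  proof (intro CollectI conjI ballI)
    show "additive_subgroup (carrier (env ?S)) (env ?S)"
      by (rule additive_subgroup_envI) auto
    show "?X \<subseteq> carrier (env ?S)"
      unfolding carrier_env by (auto intro: imageI tens_fword_closed)
  qed auto
  then have sub: "Irr A0 A1 n \<subseteq> carrier (env ?S)" unfolding Irr by (rule Inter_lower)
  have I: "additive_subgroup I (env ?S)" if "I \<in> ?\<J>" for I using that by simp
  have zero: "\<zero>\<^bsub>env ?S\<^esub> \<in> Irr A0 A1 n"
    unfolding Irr by (rule InterI) (rule additive_subgroup.zero_closed[OF I])
  show ?thesis
  proof (rule additive_subgroup_envI)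
    show "Irr A0 A1 n \<subseteq> carrier (env ?S)" by (rule sub)
    show "Irr A0 A1 n \<noteq> {}" using zero by blast
    show "\<ominus>\<^bsub>env ?S\<^esub> y \<in> Irr A0 A1 n" if y: "y \<in> Irr A0 A1 n" for y
      unfolding Irr
    proof (rule InterI)
      fix I assume "I \<in> ?\<J>"
      moreover from this have "y \<in> I" using y unfolding Irr by (rule InterD[rotated])
      ultimately show "\<ominus>\<^bsub>env ?S\<^esub> y \<in> I"
        by (intro additive_subgroup.a_inv_closed[OF I])
    qed
    show "y \<oplus>\<^bsub>env ?S\<^esub> z \<in> Irr A0 A1 n" if y: "y \<in> Irr A0 A1 n" and z: "z \<in> Irr A0 A1 n" for y z
      unfolding Irr
    proof (rule InterI)
      fix I assume "I \<in> ?\<J>"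
      moreover from this have "y \<in> I" "z \<in> I" using y z unfolding Irr by (blast dest: InterD)+
      ultimately show "y \<oplus>\<^bsub>env ?S\<^esub> z \<in> I"
        by (intro additive_subgroup.a_closed[OF I])
    qed
  qed
qed

lemma Irr_word:
  assumes "set w \<subseteq> symbs A0 A1 n \<times> symbs A0 A1 n" "irregular A0 A1 w"
  shows "env_class (symbs A0 A1 n) (fword w) \<in> Irr A0 A1 n"
  unfolding Irr_def gen_left_ideal_def Let_def using assms by blast

lemma additive_subgroup_env_gl: "additive_subgroup (env_gl A0 A1 n) (env (symbs A0 A1 n))"
proof (rule additive_subgroup_envI)
  show "env_gl A0 A1 n \<subseteq> carrier (env (symbs A0 A1 n))"
  proof
    fix u assume "u \<in> env_gl A0 A1 n"
    then obtain f where "f \<in> carrier (tens (propers n))" "u = env_class (symbs A0 A1 n) f"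
      by (rule env_gl_cases)
    then show "u \<in> carrier (env (symbs A0 A1 n))"
      unfolding carrier_env using tens_mono[OF _ propers_subset_symbs] by blast
  qed
  show "env_gl A0 A1 n \<noteq> {}" using env_gl_word[of "[]" n A0 A1] by auto
qed (auto simp: env_gl_def Let_def intro: generate_ring.intros)

lemma additive_subgroup_Virt: "additive_subgroup (Virt A0 A1 n) (env (symbs A0 A1 n))"
  unfolding Virt_def
  by (rule env.S.add_additive_subgroups[OF additive_subgroup_env_gl additive_subgroup_Irr])

lemma env_gl_subset_Virt: "env_gl A0 A1 n \<subseteq> Virt A0 A1 n"
proof
  fix u assume u: "u \<in> env_gl A0 A1 n"
  interpret G: additive_subgroup "env_gl A0 A1 n" "env (symbs A0 A1 n)" by (rule additive_subgroup_env_gl)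
  interpret I: additive_subgroup "Irr A0 A1 n" "env (symbs A0 A1 n)" by (rule additive_subgroup_Irr)
  have "u = u \<oplus>\<^bsub>env (symbs A0 A1 n)\<^esub> \<zero>\<^bsub>env (symbs A0 A1 n)\<^esub>"
    using G.a_Hcarr[OF u] by simp
  then show "u \<in> Virt A0 A1 n"
    unfolding Virt_def set_add_def' using u I.zero_closed by blast
qed

lemma Irr_subset_Virt: "Irr A0 A1 n \<subseteq> Virt A0 A1 n"
proof
  fix u assume u: "u \<in> Irr A0 A1 n"
  interpret G: additive_subgroup "env_gl A0 A1 n" "env (symbs A0 A1 n)" by (rule additive_subgroup_env_gl)
  interpret I: additive_subgroup "Irr A0 A1 n" "env (symbs A0 A1 n)" by (rule additive_subgroup_Irr)
  have "u = \<zero>\<^bsub>env (symbs A0 A1 n)\<^esub> \<oplus>\<^bsub>env (symbs A0 A1 n)\<^esub> u"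
    using I.a_Hcarr[OF u] by simp
  then show "u \<in> Virt A0 A1 n"
    unfolding Virt_def set_add_def' using u G.zero_closed by blast
qed

text \<open>\<open>Virt\<close> is the sum of the two subgroups, so a decomposition exists and the
  choice made in \<open>devirt\<close> has the required properties.\<close>

lemma devirt_in:
  assumes "x \<in> Virt A0 A1 n"
  shows "devirt A0 A1 n x \<in> env_gl A0 A1 n"
    and "x \<ominus>\<^bsub>env (symbs A0 A1 n)\<^esub> devirt A0 A1 n x \<in> Irr A0 A1 n"
proof -
  let ?S = "symbs A0 A1 n"
  interpret G: additive_subgroup "env_gl A0 A1 n" "env ?S" by (rule additive_subgroup_env_gl)
  interpret I: additive_subgroup "Irr A0 A1 n" "env ?S" by (rule additive_subgroup_Irr)
  obtain u j where uj: "u \<in> env_gl A0 A1 n" "j \<in> Irr A0 A1 n" "x = u \<oplus>\<^bsub>env ?S\<^esub> j"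
    using assms unfolding Virt_def set_add_def' by blast
  have "x \<ominus>\<^bsub>env ?S\<^esub> u = j"
    using G.a_Hcarr[OF uj(1)] I.a_Hcarr[OF uj(2)] unfolding uj(3)
    by (simp add: a_minus_def env.S.a_ac env.S.r_neg1 env.S.r_neg2 env.S.r_neg)
  then have "\<exists>u. u \<in> env_gl A0 A1 n \<and> x \<ominus>\<^bsub>env ?S\<^esub> u \<in> Irr A0 A1 n"
    using uj by auto
  then have "devirt A0 A1 n x \<in> env_gl A0 A1 n \<and> x \<ominus>\<^bsub>env ?S\<^esub> devirt A0 A1 n x \<in> Irr A0 A1 n"
    unfolding devirt_def restrict_def using assms by (simp only: if_True) (rule someI_ex)
  then show "devirt A0 A1 n x \<in> env_gl A0 A1 n" "x \<ominus>\<^bsub>env ?S\<^esub> devirt A0 A1 n x \<in> Irr A0 A1 n"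
    by auto
qed

text \<open>Moving a letter \<open>e\<^sub>a\<^sub>\<beta>\<close> to the right end makes the word irregular, and the commutators which
  arise on the way are shorter balanced words.\<close>

lemma balanced_word_in_Virt:
  assumes "\<beta> \<in> A1" and B_def: "B = insert (Virt1 \<beta>) (propers n)" and "set w \<subseteq> B \<times> B"
    and "count_list (map fst w) (Virt1 \<beta>) = count_list (map snd w) (Virt1 \<beta>)"
  shows "env_class (symbs A0 A1 n) (fword w) \<in> Virt A0 A1 n"
  using assms(3,4)
proof (induction "length w" arbitrary: w rule: less_induct)
  case less
  let ?S = "symbs A0 A1 n"
  let ?bal = "\<lambda>w. count_list (map fst w) (Virt1 \<beta>) = count_list (map snd w) (Virt1 \<beta>)"
  interpret V: additive_subgroup "Virt A0 A1 n" "env ?S" by (rule additive_subgroup_Virt)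
  have \<beta>B: "Virt1 \<beta> \<in> B" by (simp add: B_def)
  have BS: "B \<subseteq> ?S"
    using propers_subset_symbs Virt1_in_symbs[OF assms(1)] unfolding B_def by blast
  then have BBSS: "B \<times> B \<subseteq> ?S \<times> ?S" by blast
  have closed: "fword w \<in> carrier (tens ?S)" if "set w \<subseteq> B \<times> B" for w
    using that BBSS by (intro tens_fword_closed) (rule order_trans)
  show ?case
  proof (cases "Virt1 \<beta> \<in> set (map snd w)")
    \<comment> \<open>Without \<beta> in second place, the balance excludes it from first place as
      well, so the word is proper.\<close>
    case False
    then have "count_list (map snd w) (Virt1 \<beta>) = 0"
      by (simp add: count_list_0_iff)
    then have fst: "Virt1 \<beta> \<notin> set (map fst w)"
      using less.prems(2) by (metis count_list_0_iff)
    have "set w \<subseteq> propers n \<times> propers n"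
    proof
      fix x assume x: "x \<in> set w"
      have "fst x \<in> set (map fst w)" "snd x \<in> set (map snd w)" using x by simp_all
      then have "fst x \<noteq> Virt1 \<beta>" "snd x \<noteq> Virt1 \<beta>" using fst False by metis+
      then show "x \<in> propers n \<times> propers n"
        using subsetD[OF less.prems(1) x] by (cases x) (simp add: B_def)
    qed
    then show ?thesis using env_gl_word env_gl_subset_Virt by blast
  next
    case True
    then obtain a u v where w: "w = u @ (a, Virt1 \<beta>) # v"
      by (auto simp: in_set_conv_decomp)
    \<comment> \<open>An inner induction on \<open>v\<close>, the letters that
      \<open>(a, Virt1 \<beta>)\<close> still has to pass, inside the outer one on the length;
      \<open>u\<close> varies because it collects the letters already passed.\<close>
    have "env_class ?S (fword (u @ (a, Virt1 \<beta>) # v)) \<in> Virt A0 A1 n"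
      if "set (u @ (a, Virt1 \<beta>) # v) \<subseteq> B \<times> B" "?bal (u @ (a, Virt1 \<beta>) # v)"
        "length (u @ (a, Virt1 \<beta>) # v) = length w" for u v
      using that
    proof (induction v arbitrary: u)
      case Nil
      \<comment> \<open>Position 0 is the letter that acts first: it annihilates \<beta> once while
        nothing has been created.\<close>
      have "irregular A0 A1 (u @ [(a, Virt1 \<beta>)])"
        unfolding irregular_def using assms(1)
        by (intro exI[of _ 0] conjI bexI[of _ "Virt1 \<beta>"]) (auto simp: virtuals_def)
      then show ?case
        using Irr_word[of _ A0 A1 n] Irr_subset_Virt Nil.prems(1) BBSS by blast
    next
      case (Cons y v)
      obtain c d where y: "y = (c, d)" by force
      have B: "a \<in> B" "c \<in> B" "d \<in> B" "set u \<subseteq> B \<times> B" "set v \<subseteq> B \<times> B"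
        using Cons.prems(1) y by auto
      \<comment> \<open>All symbols of \<open>B\<close> have parity 1, so all letters over
        \<open>B\<close> are even and the relation is an ordinary commutator without signs.\<close>
      have par1: "par a = 1" "par c = 1" "par d = 1"
        using B(1-3) by (auto simp: B_def propers_def)
      let ?w1 = "u @ (c, d) # (a, Virt1 \<beta>) # v"
      \<comment> \<open>The two terms of the bracket are one letter shorter. Each loses \<beta>
        equally often in first and in second place, so the outer induction applies.\<close>
      let ?w2 = "u @ (a, d) # v" and ?w3 = "u @ (c, Virt1 \<beta>) # v"
      have rel: "fword (u @ (a, Virt1 \<beta>) # (c, d) # v) =
          fword ?w1 + ((if Virt1 \<beta> = c then fword ?w2 else 0) - (if a = d then fword ?w3 else 0))
          + fword u * super_rel a (Virt1 \<beta>) c d * fword v"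
      proof -
        have app: "fword (u @ xs @ v) = fword u * fword xs * fword v" for xs
          by (simp add: fword_append mult.assoc)
        have sr: "super_rel a (Virt1 \<beta>) c d = fword [(a, Virt1 \<beta>), (c, d)] - fword [(c, d), (a, Virt1 \<beta>)]
            - ((if Virt1 \<beta> = c then fword [(a, d)] else 0) - (if a = d then fword [(c, Virt1 \<beta>)] else 0))"
          by (simp add: super_rel_def par1)
        show ?thesis
          unfolding sr app[of "[(a, Virt1 \<beta>), (c, d)]", simplified] app[of "[(c, d), (a, Virt1 \<beta>)]", simplified]
            app[of "[(a, d)]", simplified] app[of "[(c, Virt1 \<beta>)]", simplified]
          by (simp add: algebra_simps)
      qed
      have ideal: "fword u * super_rel a (Virt1 \<beta>) c d * fword v \<in> env_ideal ?S"
      proof -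
        interpret I: ideal "env_ideal ?S" "tens ?S" by (rule ideal_env_ideal)
        have "super_rel a (Virt1 \<beta>) c d \<in> env_ideal ?S"
          using B BS Virt1_in_symbs[OF assms(1)] by (intro super_rel_in_env_ideal) auto
        from I.I_r_closed[OF I.I_l_closed[OF this closed[OF B(4)]] closed[OF B(5)]]
        show ?thesis by simp
      qed
      have w1: "env_class ?S (fword ?w1) \<in> Virt A0 A1 n"
      proof -
        have "env_class ?S (fword ((u @ [(c, d)]) @ (a, Virt1 \<beta>) # v)) \<in> Virt A0 A1 n"
          by (rule Cons.IH) (use Cons.prems B \<beta>B y in \<open>simp_all split: if_splits\<close>)
        then show ?thesis by simp
      qed
      have w2: "env_class ?S (if Virt1 \<beta> = c then fword ?w2 else 0) \<in> Virt A0 A1 n"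
      proof (cases "Virt1 \<beta> = c")
        case True
        have "env_class ?S (fword ?w2) \<in> Virt A0 A1 n"
          by (rule less.hyps) (use Cons.prems B \<beta>B y True in \<open>simp_all split: if_splits\<close>)
        then show ?thesis using True by simp
      qed (simp add: env_class_0)
      have w3: "env_class ?S (if a = d then fword ?w3 else 0) \<in> Virt A0 A1 n"
      proof (cases "a = d")
        case True
        have "env_class ?S (fword ?w3) \<in> Virt A0 A1 n"
          by (rule less.hyps) (use Cons.prems B \<beta>B y True in \<open>simp_all split: if_splits\<close>)
        then show ?thesis using True by simp
      qed (simp add: env_class_0)
      have c1: "fword ?w1 \<in> carrier (tens ?S)" and c2: "(if Virt1 \<beta> = c then fword ?w2 else 0) \<in> carrier (tens ?S)"
        and c3: "(if a = d then fword ?w3 else 0) \<in> carrier (tens ?S)"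
        using B \<beta>B by (simp_all add: closed tens_0_closed)
      have c4: "fword u * super_rel a (Virt1 \<beta>) c d * fword v \<in> carrier (tens ?S)"
        using ideal by (rule ideal.Icarr[OF ideal_env_ideal])
      have "env_class ?S (fword u * super_rel a (Virt1 \<beta>) c d * fword v) = env_class ?S 0"
        using ideal by (subst env_class_eq_iff[OF c4 tens_0_closed]) simp
      then have "env_class ?S (fword (u @ (a, Virt1 \<beta>) # (c, d) # v)) =
        env_class ?S (fword ?w1) \<oplus>\<^bsub>env ?S\<^esub> (env_class ?S (if Virt1 \<beta> = c then fword ?w2 else 0)
          \<oplus>\<^bsub>env ?S\<^esub> \<ominus>\<^bsub>env ?S\<^esub> env_class ?S (if a = d then fword ?w3 else 0)) \<oplus>\<^bsub>env ?S\<^esub> \<zero>\<^bsub>env ?S\<^esub>"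
        unfolding rel env_class_add[OF tens_add_closed[OF c1 tens_diff_closed[OF c2 c3]] c4]
          env_class_add[OF c1 tens_diff_closed[OF c2 c3]] env_class_diff[OF c2 c3] env_class_0 a_minus_def
        by simp
      also have "\<dots> \<in> Virt A0 A1 n"
        using w1 w2 w3 by (intro V.a_closed V.a_inv_closed V.zero_closed)
      finally show ?case unfolding y .
    qed
    from this[OF less.prems[unfolded w]] show ?thesis unfolding w by simp
  qed
qed


section \<open>From tensors to polynomials\<close>

text \<open>The commutative variables \<open>(\<beta>|t)\<close> are represented by \<open>pvar 0 t\<close>.\<close>

fun letter_poly :: "'b \<Rightarrow> ('a, 'b) symb \<times> nat \<Rightarrow> cpoly" where
  "letter_poly \<beta> (Virt0 a, t) = 0"
| "letter_poly \<beta> (Virt1 b, t) = (if b = \<beta> then pvar 0 t else 0)"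
| "letter_poly \<beta> (Prop i, t) = (if i = 0 then 0 else pvar i t)"

text \<open>Letters over \<beta> and over proper symbols are even, so commuting variables may stand
  for them; all other virtual letters are sent to 0. The map is multiplicative by
  \<open>tensor_poly_mult\<close>.\<close>

definition tensor_poly :: "'b \<Rightarrow> ((('a, 'b) symb \<times> nat) mword \<Rightarrow>\<^sub>0 complex) \<Rightarrow> cpoly" where
  "tensor_poly \<beta> = lin_ext (\<lambda>w. prod_list (map (letter_poly \<beta>) (mletters w)))"

text \<open>The default 0 is the index of \<beta>; it cannot clash because
  \<open>letter_poly\<close> gives variables to proper symbols from 1 on only.\<close>

fun symb_index :: "('a, 'b) symb \<Rightarrow> nat" where
  "symb_index (Prop i) = i"
| "symb_index _ = 0"

lemma tensor_poly_add: "tensor_poly \<beta> (p + q) = tensor_poly \<beta> p + tensor_poly \<beta> q"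
  by (simp add: tensor_poly_def lin_ext_add)

lemma tensor_poly_scal: "tensor_poly \<beta> (scal c * p) = scal c * tensor_poly \<beta> p"
  by (simp add: tensor_poly_def lin_ext_scal)

lemma tensor_poly_0 [simp]: "tensor_poly \<beta> 0 = 0"
  by (simp add: tensor_poly_def)

lemma tensor_poly_fword: "tensor_poly \<beta> (fword w) = prod_list (map (letter_poly \<beta>) w)"
  by (simp add: tensor_poly_def lin_ext_fword)

lemma tensor_poly_1 [simp]: "tensor_poly \<beta> 1 = 1"
  using tensor_poly_fword[of \<beta> "[]"] by (simp add: fword_Nil)

lemma tensor_poly_sum: "tensor_poly \<beta> (\<Sum>x\<in>A. f x) = (\<Sum>x\<in>A. tensor_poly \<beta> (f x))"
  by (induction A rule: infinite_finite_induct) (simp_all add: tensor_poly_add)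

lemma tensor_poly_mult: "tensor_poly \<beta> (p * q) = tensor_poly \<beta> p * tensor_poly \<beta> q"
proof (induction p rule: free_alg_induct)
  case (fword u)
  show ?case
  proof (induction q rule: free_alg_induct)
    case (fword v)
    then show ?case by (simp add: fword_append[symmetric] tensor_poly_fword)
  next
    case (scal c q)
    show ?case unfolding scal_left_commute tensor_poly_scal scal ..
  next
    case (add q r)
    then show ?case by (simp add: distrib_left tensor_poly_add)
  qed
next
  case (scal c p)
  then show ?case by (simp add: mult.assoc tensor_poly_scal)
next
  case (add p r)
  then show ?case by (simp add: distrib_right tensor_poly_add)
qed

text \<open>For \<open>a\<close> and \<open>b\<close> of parity 1 the operator is even and all signs
  are 1. Both sides are then ordinary derivations along \<open>tensor_poly\<close>, so a comparison
  on letters suffices.\<close>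

lemma tensor_poly_super_pol:
  assumes "a \<in> insert (Virt1 \<beta>) (Prop ` {1..})" "b \<in> insert (Virt1 \<beta>) (Prop ` {1..})"
  shows "tensor_poly \<beta> (super_pol a b p) = polar (symb_index a) (symb_index b) (tensor_poly \<beta> p)"
proof (induction p rule: free_alg_induct)
  case (fword w)
  show ?case
  proof (induction w)
    case Nil
    then show ?case by (simp add: super_pol_Nil tensor_poly_fword)
  next
    case (Cons x w)
    obtain c t where x: "x = (c, t)" by force
    have par: "par a = 1" "par b = 1" using assms by auto
    have letter: "polar (symb_index a) (symb_index b) (letter_poly \<beta> (c, t)) =
        (if b = c then letter_poly \<beta> (a, t) else 0)"
      using assms by (cases c) (auto simp: polar_pvar)
    show ?case
      unfolding x fword_Cons[of "(c, t)" w] super_pol_letter tensor_poly_add tensor_poly_mult polar_mult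
      using Cons.IH by (simp add: super_sign_def par tensor_poly_mult tensor_poly_fword letter)
  qed
next
  case (scal c p)
  then show ?case by (simp add: super_pol_scal tensor_poly_scal polar_scal)
next
  case (add p q)
  then show ?case by (simp add: super_pol_add tensor_poly_add polar_add)
qed

lemma tensor_poly_rep_fword:
  assumes "set w \<subseteq> insert (Virt1 \<beta>) (Prop ` {1..}) \<times> insert (Virt1 \<beta>) (Prop ` {1..})"
  shows "tensor_poly \<beta> (rep (fword w) p) =
    foldr (\<lambda>(a, b). polar (symb_index a) (symb_index b)) w (tensor_poly \<beta> p)"
  using assms
proof (induction w)
  case (Cons x w)
  obtain a b where x: "x = (a, b)" by force
  have "a \<in> insert (Virt1 \<beta>) (Prop ` {1..})" "b \<in> insert (Virt1 \<beta>) (Prop ` {1..})"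
    using Cons.prems x by auto
  then show ?case
    using Cons by (simp add: rep_fword x tensor_poly_super_pol)
qed (simp add: rep_fword)

text \<open>Proper letters act as polarizations on both sides. The polynomial action can thus be
  computed on any tensor lying over the polynomial.\<close>

lemma tens_act_tensor_poly:
  assumes "f \<in> carrier (tens (propers n))"
  shows "tens_act f (tensor_poly \<beta> p) = tensor_poly \<beta> (rep f p)"
proof -
  have "foldr letter_act w (tensor_poly \<beta> p) = tensor_poly \<beta> (foldr (\<lambda>(a, b). super_pol a b) w p)"
    if w: "set w \<subseteq> propers n \<times> propers n" for w :: "(('a, 'b) symb \<times> ('a, 'b) symb) list"
  proof -
    have "foldr letter_act w q = foldr (\<lambda>(a, b). polar (symb_index a) (symb_index b)) w q" for q
      using w by (induction w) (auto simp: propers_def)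
    moreover have "propers n \<subseteq> insert (Virt1 \<beta>) (Prop ` {1..})"
      by (auto simp: propers_def)
    then have "set w \<subseteq> insert (Virt1 \<beta>) (Prop ` {1..}) \<times> insert (Virt1 \<beta>) (Prop ` {1..})"
      using w by (meson Sigma_mono order_trans)
    ultimately show ?thesis by (simp only: tensor_poly_rep_fword rep_fword[symmetric])
  qed
  then show ?thesis
    using assms unfolding tens_act_def rep_def lin_ext_def tensor_poly_sum tensor_poly_scal
    by (intro sum.cong refl) (auto simp: carrier_tens)
qed

text \<open>By the expansion over permutations, \<open>hw_prod\<close> arises from variables with
  indices at most \<open>m\<close> by ring operations. The principle serves twice: for membership in
  \<open>poly_M n d\<close> and for the lift to tensors.\<close>

lemma hw_prod_induct:
  assumes parts: "\<And>r. r < length \<mu> \<Longrightarrow> \<mu> ! r \<le> m"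
    and pvar: "\<And>s t. s \<in> {1..m} \<Longrightarrow> t \<in> {1..m} \<Longrightarrow> P (pvar s t)"
    and scal: "\<And>c. P (scal c)"
    and add: "\<And>p q. P p \<Longrightarrow> P q \<Longrightarrow> P (p + q)"
    and mult: "\<And>p q. P p \<Longrightarrow> P q \<Longrightarrow> P (p * q)"
  shows "P (hw_prod \<mu>)"
proof -
  have zero: "P 0" and one: "P 1" using scal[of 0] scal[of 1] by simp_all
  have sum: "P (\<Sum>x\<in>A. f x)" if "\<And>x. x \<in> A \<Longrightarrow> P (f x)" for A and f :: "(nat \<Rightarrow> nat) \<Rightarrow> cpoly"
    using that by (induction A rule: infinite_finite_induct) (auto intro: zero add)
  have prod: "P (\<Prod>x\<in>A. f x)" if "\<And>x. x \<in> A \<Longrightarrow> P (f x)" for A and f :: "nat \<Rightarrow> cpoly"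
    using that by (induction A rule: infinite_finite_induct) (auto intro: one mult)
  have int: "P (of_int z)" for z
    using scal[of "of_int z"] by (simp add: scal_def)
  have "P (minor k Suc)" if "k \<le> m" for k
    unfolding minor_alt
  proof (intro sum mult int prod pvar)
    fix p s assume "p \<in> {p. p permutes {0..<k}}" "s \<in> {0..<k}"
    then have "p s < k" by (metis atLeastLessThan_iff mem_Collect_eq permutes_in_image)
    then show "Suc (p s) \<in> {1..m}" "Suc s \<in> {1..m}" using \<open>s \<in> {0..<k}\<close> that by auto
  qed
  then have "P (\<Prod>r<length \<mu>. minor (\<mu> ! r) Suc)"
    by (intro prod) (auto simp: parts)
  then show ?thesis by (simp add: hw_prod_def minor_def)
qed

lemma hw_prod_in_poly_M:
  assumes "\<And>r. r < length \<mu> \<Longrightarrow> \<mu> ! r \<le> m" "m \<le> n" "m \<le> d"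
  shows "hw_prod \<mu> \<in> poly_M n d"
proof (rule hw_prod_induct[of \<mu> m "\<lambda>p. p \<in> poly_M n d", OF assms(1)])
  show "pvar s t \<in> poly_M n d" if "s \<in> {1..m}" "t \<in> {1..m}" for s t
    using that assms(2,3) by (auto simp: poly_M_def pvar_def)
  show "scal c \<in> poly_M n d" for c
    by (simp add: poly_M_def scal_def)
next
  fix p q assume pq: "p \<in> poly_M n d" "q \<in> poly_M n d"
  show "p + q \<in> poly_M n d"
    using pq Poly_Mapping.keys_add[of p q] by (auto simp: poly_M_def)
  have "Poly_Mapping.keys x \<subseteq> {1..n} \<times> {1..d}" if x: "x \<in> Poly_Mapping.keys (p * q)" for x
  proof -
    obtain y z where yz: "y \<in> Poly_Mapping.keys p" "z \<in> Poly_Mapping.keys q" "x = y + z"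
      using x keys_mult[of p q] by blast
    then show ?thesis
      using pq Poly_Mapping.keys_add[of y z] unfolding poly_M_def by blast
  qed
  then show "p * q \<in> poly_M n d" by (simp add: poly_M_def)
qed

lemma proper_tensors_fword: "fst ` set w \<subseteq> range Prop \<Longrightarrow> fword w \<in> proper_tensors"
  by (simp add: proper_tensors_def fword_def)

text \<open>\<open>Irr\<close> vanishes on proper tensors, so the highest weight vector needs a
  preimage free of virtual symbols: the variable \<open>pvar s t\<close> lifts to the letter
  \<open>(Prop s, t)\<close>, and sums and products lift along the homomorphism.\<close>

lemma hw_prod_lift:
  "\<exists>p. p \<in> (proper_tensors :: ((('a, 'b) symb \<times> nat) mword \<Rightarrow>\<^sub>0 complex) set) \<and> tensor_poly \<beta> p = hw_prod \<mu>"
proof -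
  define m where "m = Max (insert 0 (set \<mu>))"
  have parts: "\<mu> ! r \<le> m" if "r < length \<mu>" for r
    using that by (simp add: m_def)
  let ?P = "\<lambda>r. \<exists>p. p \<in> (proper_tensors :: ((('a, 'b) symb \<times> nat) mword \<Rightarrow>\<^sub>0 complex) set) \<and> tensor_poly \<beta> p = r"
  show ?thesis
  proof (rule hw_prod_induct[of \<mu> m ?P, OF parts])
    fix s t assume pvar: "s \<in> {1..m}" "t \<in> {1..m}"
    have "fword [(Prop s, t)] \<in> (proper_tensors :: ((('a, 'b) symb \<times> nat) mword \<Rightarrow>\<^sub>0 complex) set)"
      by (rule proper_tensors_fword) simp
    moreover have "tensor_poly \<beta> (fword [(Prop s, t) :: ('a, 'b) symb \<times> nat]) = pvar s t"
      using pvar by (simp add: tensor_poly_fword)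
    ultimately show "?P (pvar s t)" by blast
  next
    fix c
    have "scal c \<in> (proper_tensors :: ((('a, 'b) symb \<times> nat) mword \<Rightarrow>\<^sub>0 complex) set)"
      by (simp add: proper_tensors_def scal_def zero_mword_def)
    moreover have "tensor_poly \<beta> (scal c :: (('a, 'b) symb \<times> nat) mword \<Rightarrow>\<^sub>0 complex) = scal c"
      using tensor_poly_scal[of \<beta> c "fword []"] by (simp add: tensor_poly_fword) (simp add: fword_Nil)
    ultimately show "?P (scal c)" by blast
  next
    fix p q assume "?P p" "?P q"
    then obtain p' q' :: "(('a, 'b) symb \<times> nat) mword \<Rightarrow>\<^sub>0 complex"
      where pq: "p' \<in> proper_tensors" "q' \<in> proper_tensors" "tensor_poly \<beta> p' = p" "tensor_poly \<beta> q' = q"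
      by blast
    have "p' + q' \<in> proper_tensors"
      using pq(1,2) Poly_Mapping.keys_add[of p' q'] unfolding proper_tensors_def by blast
    moreover have "tensor_poly \<beta> (p' + q') = p + q" using pq by (simp add: tensor_poly_add)
    ultimately show "?P (p + q)" by blast
  next
    fix p q assume "?P p" "?P q"
    then obtain p' q' :: "(('a, 'b) symb \<times> nat) mword \<Rightarrow>\<^sub>0 complex"
      where pq: "p' \<in> proper_tensors" "q' \<in> proper_tensors" "tensor_poly \<beta> p' = p" "tensor_poly \<beta> q' = q"
      by blast
    have "fst ` set (mletters w) \<subseteq> range Prop" if w: "w \<in> Poly_Mapping.keys (p' * q')" for w
    proof -
      obtain y z where yz: "y \<in> Poly_Mapping.keys p'" "z \<in> Poly_Mapping.keys q'" "w = y + z"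
        using w keys_mult[of p' q'] by blast
      have "fst ` set (mletters y) \<subseteq> range Prop" "fst ` set (mletters z) \<subseteq> range Prop"
        using pq(1,2) yz(1,2) unfolding proper_tensors_def by blast+
      then show ?thesis
        unfolding yz(3) by (simp add: plus_mword_def image_Un)
    qed
    then have "p' * q' \<in> proper_tensors" by (simp add: proper_tensors_def)
    moreover have "tensor_poly \<beta> (p' * q') = p * q" using pq by (simp add: tensor_poly_mult)
    ultimately show "?P (p * q)" by blast
  qed
qed


section \<open>The action of the Nazarov elements\<close>

text \<open>\<open>the_elem\<close> requires that all representatives in the proper letters act
  alike. They differ from \<open>F\<close> by elements of \<open>env_ideal\<close> for the full
  symbol set, which \<open>rep\<close> kills, and \<open>F\<close> itself is one of them.\<close>

lemma gl_act_env_class: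
  assumes F: "F \<in> carrier (tens (propers n))" and v: "tensor_poly \<beta> p \<in> poly_M n d"
  shows "gl_act n d (env_class (symbs A0 A1 n) F) (tensor_poly \<beta> p) = tensor_poly \<beta> (rep F p)"
proof -
  let ?S = "symbs A0 A1 n"
  have FS: "F \<in> carrier (tens ?S)" using F propers_subset_symbs by (rule tens_mono)
  let ?U = "env_class ?S F \<inter> carrier (tens (propers n))"
  have "tens_act f (tensor_poly \<beta> p) = tensor_poly \<beta> (rep F p)" if f: "f \<in> ?U" for f
  proof -
    have "f - F \<in> env_ideal ?S" using f in_env_class_iff[OF FS] by simp
    then have "rep (f - F) p = 0" by (rule rep_env_ideal)
    then have "rep f p = rep F p" by (simp add: rep_diff)
    then show ?thesis using f tens_act_tensor_poly[of f n \<beta> p] by simp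
  qed
  moreover have "F \<in> ?U"
  proof -
    have "F - F \<in> env_ideal ?S"
      using additive_subgroup.zero_closed[OF ideal.axioms(1)[OF ideal_env_ideal[of ?S]]] by simp
    then show ?thesis using F in_env_class_iff[OF FS] by simp
  qed
  ultimately have "(\<lambda>f. tens_act f (tensor_poly \<beta> p)) ` ?U = {tensor_poly \<beta> (rep F p)}"
    by (auto intro!: rev_image_eqI[of F])
  then show ?thesis using v by (simp add: gl_act_def)
qed

lemma nazarov_word_balanced:
  fixes \<beta> :: 'b and n :: nat and h :: "nat \<Rightarrow> nat"
  defines "w \<equiv> (nazarov_word n \<beta> h :: (('a, 'b) symb \<times> ('a, 'b) symb) list)"
  shows "set w \<subseteq> insert (Virt1 \<beta>) (propers n) \<times> insert (Virt1 \<beta>) (propers n)"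
    and "count_list (map fst w) (Virt1 \<beta>) = count_list (map snd w) (Virt1 \<beta>)"
proof -
  show "set w \<subseteq> insert (Virt1 \<beta>) (propers n) \<times> insert (Virt1 \<beta>) (propers n)"
    by (auto simp: w_def nazarov_word_def propers_def simp del: upt_Suc)
  let ?w = "\<lambda>ns. concat (map (\<lambda>i. replicate (h i) (Virt1 \<beta>, Prop i)) ns) :: (('a, 'b) symb \<times> ('a, 'b) symb) list"
  let ?w' = "\<lambda>ns. concat (map (\<lambda>i. replicate (h i) (Prop i, Virt1 \<beta>)) ns) :: (('a, 'b) symb \<times> ('a, 'b) symb) list"
  have rep: "count_list (replicate k x) y = (if x = y then k else 0)" for k and x y :: "('a, 'b) symb"
    by (induction k) auto
  have 1: "count_list (map fst (?w ns)) (Virt1 \<beta>) = sum_list (map h ns)" for ns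
    by (induction ns) (simp_all add: rep)
  have 2: "count_list (map snd (?w ns)) (Virt1 \<beta>) = 0" for ns
    by (induction ns) (simp_all add: rep)
  have 3: "count_list (map snd (?w' ns)) (Virt1 \<beta>) = sum_list (map h ns)" for ns
    by (induction ns) (simp_all add: rep)
  have 4: "count_list (map fst (?w' ns)) (Virt1 \<beta>) = 0" for ns
    by (induction ns) (simp_all add: rep)
  have 5: "sum_list (map h (rev ns)) = sum_list (map h ns)" for ns
    by (simp add: rev_map[symmetric])
  show "count_list (map fst w) (Virt1 \<beta>) = count_list (map snd w) (Virt1 \<beta>)"
    unfolding w_def nazarov_word_def map_append count_list_append 1 2 3 4 5 by simp
qed

lemma nazarov_word_polar:
  "foldr (\<lambda>(a, b). polar (symb_index a) (symb_index b))
     (nazarov_word n \<beta> h :: (('a, 'b) symb \<times> ('a, 'b) symb) list) p =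
   foldr (\<lambda>i. polar i 0) (concat (map (\<lambda>i. replicate (h i) i) (rev [1..<Suc n])))
     (foldr (polar 0) (concat (map (\<lambda>i. replicate (h i) i) [1..<Suc n])) p)"
proof -
  let ?f = "\<lambda>(a, b). polar (symb_index a) (symb_index b)"
  have 1: "foldr ?f (concat (map (\<lambda>i. replicate (h i) (Prop i, Virt1 \<beta> :: ('a, 'b) symb)) ns)) q =
      foldr (\<lambda>i. polar i 0) (concat (map (\<lambda>i. replicate (h i) i) ns)) q" for ns q
    by (induction ns arbitrary: q) simp_all
  have 2: "foldr ?f (concat (map (\<lambda>i. replicate (h i) (Virt1 \<beta> :: ('a, 'b) symb, Prop i)) ns)) q =
      foldr (polar 0) (concat (map (\<lambda>i. replicate (h i) i) ns)) q" for ns q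
    by (induction ns arbitrary: q) simp_all
  show ?thesis
    unfolding nazarov_word_def foldr_append o_apply 1 2 ..
qed

text \<open>Each word differs from its devirtualization by an element of \<open>Irr\<close>, which
  vanishes on the proper tensor \<open>p\<close>. So the virtual word may act in its place, and its
  letters become polarizations with 0 as the index of \<beta>.\<close>

lemma gl_act_nazarov:
  fixes A0 :: "'a set" and A1 :: "'b set"
  assumes \<beta>: "\<beta> \<in> A1" and p: "p \<in> (proper_tensors :: ((('a, 'b) symb \<times> nat) mword \<Rightarrow>\<^sub>0 complex) set)"
    and v: "tensor_poly \<beta> p \<in> poly_M n d"
  shows "gl_act n d (nazarov A0 A1 n \<beta> k) (tensor_poly \<beta> p) =
    (\<Sum>h \<in> {h \<in> {1..n} \<rightarrow>\<^sub>E UNIV. (\<Sum>i = 1..n. h i) = k}. scal (1 / (\<Prod>i = 1..n. fact (h i))) *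
       foldr (\<lambda>i. polar i 0) (concat (map (\<lambda>i. replicate (h i) i) (rev [1..<Suc n])))
         (foldr (polar 0) (concat (map (\<lambda>i. replicate (h i) i) [1..<Suc n])) (tensor_poly \<beta> p)))"
proof -
  let ?S = "symbs A0 A1 n"
  define B where "B = insert (Virt1 \<beta>) (propers n :: ('a, 'b) symb set)"
  define W where "W h = fword (nazarov_word n \<beta> h :: (('a, 'b) symb \<times> ('a, 'b) symb) list)" for h
  define H where "H = {h \<in> {1..n} \<rightarrow>\<^sub>E UNIV. (\<Sum>i = 1..n. h i) = k}"
  define c where "c h = 1 / (\<Prod>i = 1..n. fact (h i) :: complex)" for h
  have H: "finite H" unfolding H_def by (rule finite_compositions)
  have setW: "set (nazarov_word n \<beta> h :: (('a, 'b) symb \<times> ('a, 'b) symb) list) \<subseteq> B \<times> B" for h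
    unfolding B_def by (rule nazarov_word_balanced)
  have "B \<subseteq> ?S"
    unfolding B_def using propers_subset_symbs Virt1_in_symbs[OF \<beta>] by blast
  then have "B \<times> B \<subseteq> ?S \<times> ?S" by blast
  then have WS: "W h \<in> carrier (tens ?S)" for h
    unfolding W_def using setW by (intro tens_fword_closed) (rule order_trans)
  have "\<exists>f. f \<in> carrier (tens (propers n)) \<and> devirt A0 A1 n (env_class ?S (W h)) = env_class ?S f \<and>
      rep f p = rep (W h) p" for h
  proof -
    have Virt: "env_class ?S (W h) \<in> Virt A0 A1 n"
      unfolding W_def by (rule balanced_word_in_Virt[OF \<beta> B_def setW nazarov_word_balanced(2)])
    obtain f where f: "f \<in> carrier (tens (propers n))" "devirt A0 A1 n (env_class ?S (W h)) = env_class ?S f"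
      using devirt_in(1)[OF Virt] by (rule env_gl_cases)
    have fS: "f \<in> carrier (tens ?S)" using f(1) propers_subset_symbs by (rule tens_mono)
    have "env_class ?S (W h - f) \<in> Irr A0 A1 n"
      using devirt_in(2)[OF Virt] unfolding f(2) env_class_diff[OF WS fS] .
    from Irr_annihilates[OF this]
    obtain g where g: "g \<in> carrier (tens ?S)" "env_class ?S (W h - f) = env_class ?S g"
      "\<forall>p \<in> proper_tensors. rep g p = 0" by (elim bexE conjE)
    have "rep (W h - f) p = rep g p"
      by (rule env_class_eq_rep[OF tens_diff_closed[OF WS fS] g(1,2)])
    also have "\<dots> = 0" using g(3) p by (rule bspec)
    finally have "rep f p = rep (W h) p" by (simp add: rep_diff)
    then show ?thesis using f by (intro exI[of _ f] conjI)
  qed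
  \<comment> \<open>A proper representative is chosen for every \<open>h\<close>; the weighted sum
    \<open>F\<close> of these then represents the Nazarov element itself.\<close>
  then obtain f where f: "\<And>h. f h \<in> carrier (tens (propers n))"
      "\<And>h. devirt A0 A1 n (env_class ?S (W h)) = env_class ?S (f h)" "\<And>h. rep (f h) p = rep (W h) p"
    by metis
  define F where "F = (\<Sum>h\<in>H. scal (c h) * f h)"
  have cf: "scal (c h) * f h \<in> carrier (tens (propers n))" for h
    by (intro tens_mult_closed tens_scal_closed f)
  have F: "F \<in> carrier (tens (propers n))"
    unfolding F_def by (intro tens_sum_closed cf)
  have "nazarov A0 A1 n \<beta> k = (\<Oplus>\<^bsub>env ?S\<^esub>h\<in>H. env_class ?S (scal (c h) * f h))"
  proof -
    have "env_class ?S (scal (c h)) \<otimes>\<^bsub>env ?S\<^esub> devirt A0 A1 n (env_class ?S (W h)) =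
        env_class ?S (scal (c h) * f h)" for h
      unfolding f(2) using env_class_mult[OF tens_scal_closed tens_mono[OF f(1) propers_subset_symbs], symmetric] .
    then show ?thesis
      unfolding nazarov_def Let_def W_def[symmetric] H_def[symmetric] c_def[symmetric] by simp
  qed
  also have "\<dots> = env_class ?S F"
    unfolding F_def by (rule env_class_finsum[OF H tens_mono[OF cf propers_subset_symbs]])
  finally have "gl_act n d (nazarov A0 A1 n \<beta> k) (tensor_poly \<beta> p) = tensor_poly \<beta> (rep F p)"
    using gl_act_env_class[OF F v] by simp
  also have "rep F p = (\<Sum>h\<in>H. scal (c h) * rep (W h) p)"
    unfolding F_def rep_sum rep_scal f(3) ..
  also have "tensor_poly \<beta> \<dots> = (\<Sum>h\<in>H. scal (c h) * tensor_poly \<beta> (rep (W h) p))"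
    unfolding tensor_poly_sum tensor_poly_scal ..
  also have "\<dots> = (\<Sum>h\<in>H. scal (c h) *
       foldr (\<lambda>i. polar i 0) (concat (map (\<lambda>i. replicate (h i) i) (rev [1..<Suc n])))
         (foldr (polar 0) (concat (map (\<lambda>i. replicate (h i) i) [1..<Suc n])) (tensor_poly \<beta> p)))"
  proof (intro sum.cong refl arg_cong[of _ _ "\<lambda>q. scal _ * q"])
    fix h
    have "B \<subseteq> insert (Virt1 \<beta>) (Prop ` {1..})"
      unfolding B_def by (auto simp: propers_def)
    then have "B \<times> B \<subseteq> insert (Virt1 \<beta>) (Prop ` {1..}) \<times> insert (Virt1 \<beta>) (Prop ` {1..})"
      by (intro Sigma_mono)
    then have "tensor_poly \<beta> (rep (W h) p) = foldr (\<lambda>(a, b). polar (symb_index a) (symb_index b))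
        (nazarov_word n \<beta> h :: (('a, 'b) symb \<times> ('a, 'b) symb) list) (tensor_poly \<beta> p)"
      unfolding W_def using setW[of h] by (intro tensor_poly_rep_fword) (rule order_trans)
    then show "tensor_poly \<beta> (rep (W h) p) =
       foldr (\<lambda>i. polar i 0) (concat (map (\<lambda>i. replicate (h i) i) (rev [1..<Suc n])))
         (foldr (polar 0) (concat (map (\<lambda>i. replicate (h i) i) [1..<Suc n])) (tensor_poly \<beta> p))"
      unfolding nazarov_word_polar .
  qed
  finally show ?thesis unfolding H_def c_def .
qed

lemma part_le_first_part:
  assumes "is_partition \<mu>" "r < length \<mu>"
  shows "\<mu> ! r \<le> first_part \<mu>"
  using assms sorted_wrt_nth_less[of "(\<ge>)" \<mu> 0 r]
  by (cases \<mu>; cases r) (auto simp: is_partition_def first_part_def)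

theorem theorem4p23:
  fixes A0 :: "'a set" and A1 :: "'b set" and \<beta> :: 'b
    and n d k :: nat and \<mu> :: "nat list" and \<epsilon> :: complex and v :: cpoly
  assumes "finite A0" and "finite A1" and "\<beta> \<in> A1"
    and "k > 0"
    and "is_partition \<mu>" and "first_part \<mu> \<le> n" and "first_part \<mu> \<le> d"
    and "\<epsilon> = 1 \<or> \<epsilon> = - 1" and "v = scal \<epsilon> * hw_prod \<mu>"
  shows "\<exists>h \<in> \<nat>. gl_act n d (nazarov A0 A1 n \<beta> k) v = scal h * v \<and>
           h = of_nat (\<Sum>V \<in> vstrips \<mu> k. vstrip_fact V)"
proof -
  let ?h = "\<Sum>V \<in> vstrips \<mu> k. vstrip_fact V"
  obtain q :: "(('a, 'b) symb \<times> nat) mword \<Rightarrow>\<^sub>0 complex"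
    where q: "q \<in> proper_tensors" "tensor_poly \<beta> q = hw_prod \<mu>"
    using hw_prod_lift[of \<beta> \<mu>] by blast
  define p where "p = scal \<epsilon> * q"
  have p: "p \<in> proper_tensors"
    using q(1) keys_scal_mult_subset[of \<epsilon> q] unfolding p_def proper_tensors_def by blast
  have pv: "tensor_poly \<beta> p = v"
    by (simp add: p_def tensor_poly_scal q assms(9))
  \<comment> \<open>\<open>gl_act\<close> is a restricted function; the bounds of the first part by
    \<open>n\<close> and \<open>d\<close> put the vector into its domain.\<close>
  have "hw_prod \<mu> \<in> poly_M n d"
    by (rule hw_prod_in_poly_M[OF part_le_first_part[OF assms(5)] assms(6,7)])
  then have v: "v \<in> poly_M n d"
    using keys_scal_mult_subset[of \<epsilon> "hw_prod \<mu>"] unfolding assms(9) poly_M_def by blast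
  have parts: "snd x < n" if "x \<in> ferrers \<mu>" for x
    using that part_le_first_part[OF assms(5)] assms(6) by (fastforce simp: ferrers_def)
  \<comment> \<open>The sign passes through all operators by linearity, so \<open>v\<close> has the
    eigenvalue of \<open>hw_prod \<mu>\<close>.\<close>
  have linear1: "foldr (\<lambda>i. polar i 0) w (scal \<epsilon> * r) = scal \<epsilon> * foldr (\<lambda>i. polar i 0) w r" for w r
    by (induction w) (simp_all add: polar_scal)
  have linear2: "foldr (polar 0) w (scal \<epsilon> * r) = scal \<epsilon> * foldr (polar 0) w r" for w r
    by (induction w) (simp_all add: polar_scal)
  have "gl_act n d (nazarov A0 A1 n \<beta> k) v = scal \<epsilon> *
    (\<Sum>h \<in> {h \<in> {1..n} \<rightarrow>\<^sub>E UNIV. (\<Sum>i = 1..n. h i) = k}. scal (1 / (\<Prod>i = 1..n. fact (h i))) *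
       foldr (\<lambda>i. polar i 0) (concat (map (\<lambda>i. replicate (h i) i) (rev [1..<Suc n])))
         (foldr (polar 0) (concat (map (\<lambda>i. replicate (h i) i) [1..<Suc n])) (hw_prod \<mu>)))"
    unfolding gl_act_nazarov[OF assms(3) p v[folded pv], unfolded pv]
    unfolding assms(9) linear1 linear2 sum_distrib_left mult.left_commute[of "scal _" "scal \<epsilon>"] ..
  also have "\<dots> = scal \<epsilon> * (of_nat ?h * hw_prod \<mu>)"
    by (rule arg_cong[of _ _ "(*) (scal \<epsilon>)"]) (rule sum_nazarov_polar[OF parts])
  also have "\<dots> = scal (of_nat ?h) * v"
    unfolding assms(9) scal_def single_of_nat by (rule mult.left_commute)
  finally show ?thesis by (intro bexI[of _ "of_nat ?h"] conjI refl of_nat_in_Nats)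
qed

end
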